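(* Let $X$ be a path connected, locally path connected, paracompact Hausdorff space with basepoint $x_0$. Then $X$ is $\pi_1$-shape injective if and only if $\pi^{Sp}(X,x_0)=1$.
   Context: Paths are continuous maps from $[0,1]$, $\overline{\alpha}$ is the reverse path, and $[\alpha][\beta]=[\alpha\ast\beta]$ denotes concatenation of homotopy classes rel. endpoints. Spanier groups. For an open cover $\mathscr{U}$ of $X$, $\pi^{Sp}(\mathscr{U},x_0)$ is the subgroup of $\pi_1(X,x_0)$ generated by all elements $[\alpha][\gamma][\overline{\alpha}]$ where $\alpha$ is a path with $\alpha(0)=x_0$ and $\gamma$ is a loop based at $\alpha(1)$ with image in some $U\in\mathscr{U}$. The Spanier group is $\pi^{Sp}(X,x_0)=\bigcap_{\mathscr{U}}\pi^{Sp}(\mathscr{U},x_0)$, over all open covers $\mathscr{U}$ of $X$. First shape group. Consider pairs $(\mathscr{U},U_0)$ with $\mathscr{U}$ an open cover of $X$ and $x_0\in U_0\in\mathscr{U}$. $(\mathscr{V},V_0)$ refines $(\mathscr{U},U_0)$ if $\mathscr{V}$ refines $\mathscr{U}$ and $V_0\subseteq U_0$. The nerve $N(\mathscr{U})$ is the abstract simplicial complex with vertex set $\mathscr{U}$, in which $A_0,\dots,A_n$ span a simplex iff $\bigcap_i A_i\neq\emptyset$; $|N(\mathscr{U})|$ is its geometric realization, based at the vertex $U_0$. Let $\Lambda$ be the set of pairs $(\mathscr{U},U_0)$ admitting a partition of unity $\{\phi_U\}_{U\in\mathscr{U}}$ subordinated to $\mathscr{U}$ with $\phi_{U_0}(x_0)=1$,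 directed by refinement. If $(\mathscr{V},V_0)$ refines $(\mathscr{U},U_0)$, any vertex assignment $V\mapsto U$ with $V\subseteq U$ and $V_0\mapsto U_0$ defines a simplicial map $N(\mathscr{V})\to N(\mathscr{U})$ whose realization is unique up to based homotopy; the induced homomorphism is $p_{\mathscr{U}\mathscr{V}\ast}:\pi_1(|N(\mathscr{V})|,V_0)\to\pi_1(|N(\mathscr{U})|,U_0)$. Set $\check{\pi}_1(X,x_0)=\varprojlim(\pi_1(|N(\mathscr{U})|,U_0),p_{\mathscr{U}\mathscr{V}\ast},\Lambda)$. A canonical map for $(\mathscr{U},U_0)$ is a continuous map $p_{\mathscr{U}}:X\to|N(\mathscr{U})|$ with $p_{\mathscr{U}}(x_0)=U_0$ and $p_{\mathscr{U}}^{-1}(St(U,N(\mathscr{U})))\subseteq U$ for all $U\in\mathscr{U}$, where $St(U,N(\mathscr{U}))$ is the open star of the vertex $U$. For $(\mathscr{U},U_0)\in\Lambda$ canonical maps exist and are unique up to based homotopy, and they are compatible with the maps $p_{\mathscr{U}\mathscr{V}\ast}$ on $\pi_1$. Define $\Psi_X:\pi_1(X,x_0)\to\check{\pi}_1(X,x_0)$ by $\Psi_X([\alpha])=([p_{\mathscr{U}}\circ\alpha])_{(\mathscr{U},U_0)\in\Lambda}$. $X$ is $\pi_1$-shape injective if $\ker\Psi_X=1$. *)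

theory Defs
  imports "HOL-Analysis.Analysis" "HOL-Algebra.Product_Groups"
begin

section \<open>Paths and the fundamental group of an abstract topology\<close>

text \<open>
  The type-class notions \<open>(+++)\<close>, \<open>reversepath\<close> and \<open>homotopic_paths\<close> are restated here for
  abstract topologies, because the realization of a nerve carries the weak topology, which is
  not the one given by the type class instance for functions.
  A path is a function on all reals; only its values on the unit interval matter, and
  a path class contains all extensions.
\<close>

definition path_join :: "(real \<Rightarrow> 'a) \<Rightarrow> (real \<Rightarrow> 'a) \<Rightarrow> real \<Rightarrow> 'a" where
  "path_join p q = (\<lambda>t. if t \<le> 1/2 then p (2 * t) else q (2 * t - 1))"

definition path_reverse :: "(real \<Rightarrow> 'a) \<Rightarrow> real \<Rightarrow> 'a" where
  "path_reverse p = (\<lambda>t. p (1 - t))"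

definition path_homotopic :: "'a topology \<Rightarrow> (real \<Rightarrow> 'a) \<Rightarrow> (real \<Rightarrow> 'a) \<Rightarrow> bool" where
  "path_homotopic X p q \<longleftrightarrow>
     homotopic_with (\<lambda>r. r 0 = p 0 \<and> r 1 = p 1) (top_of_set {0..1}) X p q"

definition path_class :: "'a topology \<Rightarrow> (real \<Rightarrow> 'a) \<Rightarrow> (real \<Rightarrow> 'a) set" where
  "path_class X p = {q. path_homotopic X p q}"

definition loops :: "'a topology \<Rightarrow> 'a \<Rightarrow> (real \<Rightarrow> 'a) set" where
  "loops X x0 = {p. pathin X p \<and> p 0 = x0 \<and> p 1 = x0}"

text \<open>
  The union over representatives below is the single class \<open>[p \<cdot> q]\<close>
  (see \<open>mult_fundamental_group\<close>).
\<close>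

definition fundamental_group :: "'a topology \<Rightarrow> 'a \<Rightarrow> (real \<Rightarrow> 'a) set monoid" where
  "fundamental_group X x0 =
     \<lparr>carrier = path_class X ` loops X x0,
      monoid.mult = (\<lambda>A B. \<Union>p\<in>A. \<Union>q\<in>B. path_class X (path_join p q)),
      one = path_class X (\<lambda>_. x0)\<rparr>"

text \<open>
  The map induced on path classes by a continuous map \<open>f\<close> into \<open>Y\<close>; the union is again a
  single class (see \<open>induced_map_path_class\<close>).
\<close>

definition induced_map :: "'b topology \<Rightarrow> ('a \<Rightarrow> 'b) \<Rightarrow> (real \<Rightarrow> 'a) set \<Rightarrow> (real \<Rightarrow> 'b) set" where
  "induced_map Y f A = (\<Union>p\<in>A. path_class Y (f \<circ> p))"

lemma path_homotopic_refl: "pathin X p \<Longrightarrow> path_homotopic X p p"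
  by (simp add: path_homotopic_def pathin_def)

lemma path_homotopic_ends:
  assumes "path_homotopic X p q" shows "q 0 = p 0" "q 1 = p 1"
  using homotopic_with_imp_property[OF assms[unfolded path_homotopic_def]] by auto

lemma path_homotopic_imp_pathin:
  assumes "path_homotopic X p q" shows "pathin X p" "pathin X q"
  using homotopic_with_imp_continuous_maps[OF assms[unfolded path_homotopic_def]]
  by (auto simp: pathin_def)

lemma path_homotopic_sym:
  assumes "path_homotopic X p q" shows "path_homotopic X q p"
  using assms path_homotopic_ends[OF assms]
  unfolding path_homotopic_def by (simp add: homotopic_with_sym)

lemma path_homotopic_trans:
  assumes "path_homotopic X p q" "path_homotopic X q r" shows "path_homotopic X p r"
  using assms path_homotopic_ends[OF assms(1)]
  unfolding path_homotopic_def by (auto intro: homotopic_with_trans)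

lemma path_class_eq_iff:
  assumes "pathin X p"
  shows "path_class X p = path_class X q \<longleftrightarrow> path_homotopic X p q"
  unfolding path_class_def using assms
  by (blast intro: path_homotopic_refl path_homotopic_sym path_homotopic_trans)

lemma path_homotopic_compose:
  assumes "path_homotopic X p q" and f: "continuous_map X Y f"
  shows "path_homotopic Y (f \<circ> p) (f \<circ> q)"
  using homotopic_with_compose_continuous_map_left[OF assms(1)[unfolded path_homotopic_def] f,
      of "\<lambda>r. r 0 = (f \<circ> p) 0 \<and> r 1 = (f \<circ> p) 1"]
  by (simp add: path_homotopic_def)

lemma induced_map_path_class:
  assumes p: "pathin X p" and f: "continuous_map X Y f"
  shows "induced_map Y f (path_class X p) = path_class Y (f \<circ> p)"
proof -
  have "path_class Y (f \<circ> q) = path_class Y (f \<circ> p)" if "q \<in> path_class X p" for q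
    using that path_homotopic_compose[OF _ f] p
    by (metis f mem_Collect_eq path_class_def path_class_eq_iff pathin_compose)
  moreover have "p \<in> path_class X p"
    by (simp add: path_class_def p path_homotopic_refl)
  ultimately show ?thesis unfolding induced_map_def by blast
qed

lemma path_homotopic_reparam:
  assumes P: "pathin X P"
    and \<phi>: "continuous_on {0..1} \<phi>" "\<phi> ` {0..1} \<subseteq> {0..1}"
    and \<psi>: "continuous_on {0..1} \<psi>" "\<psi> ` {0..1} \<subseteq> {0..1::real}"
    and ends: "\<psi> 0 = \<phi> 0" "\<psi> 1 = \<phi> 1"
    and p: "\<And>t. t \<in> {0..1} \<Longrightarrow> p t = P (\<phi> t)"
    and q: "\<And>t. t \<in> {0..1} \<Longrightarrow> q t = P (\<psi> t)"
  shows "path_homotopic X p q"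
proof -
  have "homotopic_paths {0..1} \<phi> \<psi>"
  proof (rule homotopic_paths_linear)
    show "closed_segment (\<phi> t) (\<psi> t) \<subseteq> {0..1}" if "t \<in> {0..1}" for t
      using that \<phi>(2) \<psi>(2) by (meson convex_contains_segment convex_real_interval(5) image_subset_iff)
  qed (use \<phi> \<psi> ends in \<open>auto simp: path_def pathstart_def pathfinish_def\<close>)
  then have "path_homotopic (top_of_set {0..1}) \<phi> \<psi>"
    by (simp add: homotopic_paths_def path_homotopic_def pathstart_def pathfinish_def)
  then have "path_homotopic X (P \<circ> \<phi>) (P \<circ> \<psi>)"
    by (rule path_homotopic_compose) (use P in \<open>simp add: pathin_def\<close>)
  moreover have "p 0 = P (\<phi> 0)" "p 1 = P (\<phi> 1)"
    by (auto simp: p)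
  ultimately have "homotopic_with (\<lambda>r. r 0 = p 0 \<and> r 1 = p 1) (top_of_set {0..1}) X (P \<circ> \<phi>) (P \<circ> \<psi>)"
    by (simp add: path_homotopic_def)
  then show ?thesis
    unfolding path_homotopic_def
    by (rule homotopic_with_eq) (auto simp: p q)
qed

lemma path_homotopic_join:
  assumes 1: "path_homotopic X p p'" and 2: "path_homotopic X q q'" and pq: "p 1 = q 0"
  shows "path_homotopic X (path_join p q) (path_join p' q')"
proof -
  obtain h where h: "continuous_map (prod_topology (top_of_set {0..1::real}) (top_of_set {0..1})) X h"
     "\<forall>x. h (0, x) = p x" "\<forall>x. h (1, x) = p' x"
     "\<forall>t\<in>{0..1}. h (t, 0) = p 0 \<and> h (t, 1) = p 1"
    using 1 unfolding path_homotopic_def homotopic_with_def by blast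
  obtain k where k: "continuous_map (prod_topology (top_of_set {0..1::real}) (top_of_set {0..1})) X k"
     "\<forall>x. k (0, x) = q x" "\<forall>x. k (1, x) = q' x"
     "\<forall>t\<in>{0..1}. k (t, 0) = q 0 \<and> k (t, 1) = q 1"
    using 2 unfolding path_homotopic_def homotopic_with_def by blast
  let ?I = "{0..1::real}"
  let ?S = "prod_topology (top_of_set ?I) (top_of_set ?I)"
  have S: "?S = top_of_set (?I \<times> ?I)" by (simp add: prod_topology_subtopology_eu)
  let ?H = "\<lambda>z. if snd z \<le> 1/2 then h (fst z, 2 * snd z) else k (fst z, 2 * snd z - 1)"
  have "continuous_map ?S X ?H"
  proof (rule continuous_map_cases_le)
    show "continuous_map ?S euclideanreal snd" "continuous_map ?S euclideanreal (\<lambda>z. 1/2)"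
      unfolding S by (auto intro!: continuous_intros)
    have "continuous_map (subtopology ?S {z \<in> topspace ?S. snd z \<le> 1/2}) X
        (h \<circ> (\<lambda>z. (fst z, 2 * snd z)))"
      by (rule continuous_map_compose[OF _ h(1)[unfolded S]], unfold S subtopology_subtopology)
         (auto intro!: continuous_intros)
    then show "continuous_map (subtopology ?S {z \<in> topspace ?S. snd z \<le> 1/2}) X
        (\<lambda>z. h (fst z, 2 * snd z))" by (simp add: o_def)
    have "continuous_map (subtopology ?S {z \<in> topspace ?S. 1/2 \<le> snd z}) X
        (k \<circ> (\<lambda>z. (fst z, 2 * snd z - 1)))"
      by (rule continuous_map_compose[OF _ k(1)[unfolded S]], unfold S subtopology_subtopology)
         (auto intro!: continuous_intros)
    then show "continuous_map (subtopology ?S {z \<in> topspace ?S. 1/2 \<le> snd z}) X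
        (\<lambda>z. k (fst z, 2 * snd z - 1))" by (simp add: o_def)
    show "h (fst z, 2 * snd z) = k (fst z, 2 * snd z - 1)"
      if "z \<in> topspace ?S" "snd z = 1/2" for z
    proof -
      have "2 * snd z = 1" "2 * snd z - 1 = 0" using that(2) by simp_all
      then show ?thesis using that(1) h(4) k(4) pq by (simp only: S) (auto simp: mem_Times_iff)
    qed
  qed
  then show ?thesis
    unfolding path_homotopic_def homotopic_with_def
    by (intro exI[of _ ?H]) (auto simp: path_join_def h k)
qed

lemma pathin_join:
  assumes "pathin X p" "pathin X q" "p 1 = q 0"
  shows "pathin X (path_join p q)"
  by (rule path_homotopic_imp_pathin(1)[OF path_homotopic_join]) (use assms path_homotopic_refl in auto)

lemma loops_join: "p \<in> loops X x0 \<Longrightarrow> q \<in> loops X x0 \<Longrightarrow> path_join p q \<in> loops X x0"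
  by (simp add: loops_def pathin_join) (simp add: path_join_def)

lemma mult_fundamental_group:
  assumes p: "p \<in> loops X x0" and q: "q \<in> loops X x0"
  shows "path_class X p \<otimes>\<^bsub>fundamental_group X x0\<^esub> path_class X q = path_class X (path_join p q)"
proof -
  have "path_class X (path_join p' q') = path_class X (path_join p q)"
    if "p' \<in> path_class X p" "q' \<in> path_class X q" for p' q'
  proof -
    have "path_homotopic X (path_join p q) (path_join p' q')"
      using that p q by (intro path_homotopic_join) (auto simp: path_class_def loops_def)
    then show ?thesis
      using path_class_eq_iff path_homotopic_imp_pathin(1) by metis
  qed
  moreover have "p \<in> path_class X p" "q \<in> path_class X q"
    using p q by (auto simp: path_class_def loops_def path_homotopic_refl)
  ultimately have "(\<Union>p'\<in>path_class X p. \<Union>q'\<in>path_class X q. path_class X (path_join p' q')) =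
      path_class X (path_join p q)" by blast
  then show ?thesis by (simp add: fundamental_group_def)
qed

lemma path_join_assoc:
  assumes "pathin X p" "pathin X q" "pathin X r" "p 1 = q 0" "q 1 = r 0"
  shows "path_homotopic X (path_join (path_join p q) r) (path_join p (path_join q r))"
proof (rule path_homotopic_reparam
    [where P = "path_join p (path_join q r)" and \<psi> = "\<lambda>t. t"
      and \<phi> = "\<lambda>t. min (min (2 * t) (t + 1/4)) ((t + 1) / 2)"])
  have "path_join q r 0 = q 0" by (simp add: path_join_def)
  then show "pathin X (path_join p (path_join q r))"
    using assms by (intro pathin_join) auto
  show "path_join (path_join p q) r t =
      path_join p (path_join q r) (min (min (2 * t) (t + 1/4)) ((t + 1) / 2))" if "t \<in> {0..1}" for t
  proof -
    consider "t \<le> 1/4" | "1/4 < t" "t \<le> 1/2" | "1/2 < t" by linarith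
    then show ?thesis
    proof cases
      case 1
      then have "min (min (2 * t) (t + 1/4)) ((t + 1) / 2) = 2 * t" using that by auto
      with 1 show ?thesis by (simp add: path_join_def)
    next
      case 2
      then have "min (min (2 * t) (t + 1/4)) ((t + 1) / 2) = t + 1/4" using that by auto
      with 2 show ?thesis by (simp add: path_join_def algebra_simps)
    next
      case 3
      then have "min (min (2 * t) (t + 1/4)) ((t + 1) / 2) = (t + 1) / 2" using that by auto
      moreover have "2 * (2 * ((t + 1) / 2) - 1) - 1 = 2 * t - 1" by simp
      moreover have "\<not> (t + 1) / 2 \<le> 1/2" "\<not> 2 * ((t + 1) / 2) - 1 \<le> 1/2" using 3 by simp_all
      ultimately show ?thesis using 3 by (simp only: path_join_def not_le[symmetric] if_False)
    qed
  qed
  show "(\<lambda>t::real. min (min (2 * t) (t + 1/4)) ((t + 1) / 2)) ` {0..1} \<subseteq> {0..1}"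
    by (auto simp: min_le_iff_disj)
qed (auto intro!: continuous_intros)

lemma path_join_const_left:
  assumes "pathin X p"
  shows "path_homotopic X (path_join (\<lambda>_. p 0) p) p"
  by (rule path_homotopic_reparam[where P = p and \<psi> = "\<lambda>t. t" and \<phi> = "\<lambda>t. max 0 (2 * t - 1)"])
     (use assms in \<open>auto intro!: continuous_intros simp: path_join_def\<close>)

lemma path_join_reverse_left:
  assumes "pathin X p"
  shows "path_homotopic X (path_join (path_reverse p) p) (\<lambda>_. p 1)"
  by (rule path_homotopic_reparam[where P = p and \<psi> = "\<lambda>t. 1" and \<phi> = "\<lambda>t. \<bar>2 * t - 1\<bar>"])
     (use assms in \<open>auto intro!: continuous_intros simp: path_join_def path_reverse_def\<close>)

lemma pathin_reverse:
  assumes "pathin X p" shows "pathin X (path_reverse p)"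
proof -
  have "continuous_map (top_of_set {0..1}) X (p \<circ> (\<lambda>t. 1 - t))"
    by (rule continuous_map_compose[OF _ assms[unfolded pathin_def]])
       (auto intro!: continuous_intros)
  then show ?thesis by (simp add: pathin_def path_reverse_def o_def)
qed

lemma group_fundamental_group:
  assumes "x0 \<in> topspace X"
  shows "group (fundamental_group X x0)"
proof (rule groupI)
  let ?G = "fundamental_group X x0"
  have carrier: "carrier ?G = path_class X ` loops X x0"
    and one: "\<one>\<^bsub>?G\<^esub> = path_class X (\<lambda>_. x0)" by (simp_all add: fundamental_group_def)
  have const: "(\<lambda>_. x0) \<in> loops X x0"
    using assms by (simp add: loops_def pathin_def)
  show "\<one>\<^bsub>?G\<^esub> \<in> carrier ?G" using const by (simp add: carrier one)
  show "A \<otimes>\<^bsub>?G\<^esub> B \<in> carrier ?G" if "A \<in> carrier ?G" "B \<in> carrier ?G" for A B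
    using that by (auto simp: carrier mult_fundamental_group loops_join)
  show "A \<otimes>\<^bsub>?G\<^esub> B \<otimes>\<^bsub>?G\<^esub> C = A \<otimes>\<^bsub>?G\<^esub> (B \<otimes>\<^bsub>?G\<^esub> C)"
    if ABC: "A \<in> carrier ?G" "B \<in> carrier ?G" "C \<in> carrier ?G" for A B C
  proof -
    obtain p q r where pqr: "p \<in> loops X x0" "q \<in> loops X x0" "r \<in> loops X x0"
      and eq: "A = path_class X p" "B = path_class X q" "C = path_class X r"
      using ABC unfolding carrier by blast
    have "path_homotopic X (path_join (path_join p q) r) (path_join p (path_join q r))"
      using pqr by (intro path_join_assoc) (auto simp: loops_def)
    then have "path_class X (path_join (path_join p q) r) = path_class X (path_join p (path_join q r))"
      using path_class_eq_iff path_homotopic_imp_pathin(1) by metis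
    then show ?thesis using pqr by (simp add: eq mult_fundamental_group loops_join)
  qed
  show "\<one>\<^bsub>?G\<^esub> \<otimes>\<^bsub>?G\<^esub> A = A" if A: "A \<in> carrier ?G" for A
  proof -
    obtain p where p: "p \<in> loops X x0" "A = path_class X p" using A by (auto simp: carrier)
    then have "path_homotopic X (path_join (\<lambda>_. x0) p) p"
      using path_join_const_left[of X p] by (simp add: loops_def)
    then have "path_class X (path_join (\<lambda>_. x0) p) = path_class X p"
      using path_class_eq_iff path_homotopic_imp_pathin(1) by metis
    then show ?thesis using p const by (simp add: one mult_fundamental_group)
  qed
  show "\<exists>B\<in>carrier ?G. B \<otimes>\<^bsub>?G\<^esub> A = \<one>\<^bsub>?G\<^esub>" if A: "A \<in> carrier ?G" for A
  proof -
    obtain p where p: "p \<in> loops X x0" "A = path_class X p" using A by (auto simp: carrier)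
    have r: "path_reverse p \<in> loops X x0"
      using p(1) pathin_reverse[of X p] by (auto simp: loops_def path_reverse_def)
    have "path_homotopic X (path_join (path_reverse p) p) (\<lambda>_. x0)"
      using path_join_reverse_left[of X p] p(1) by (simp add: loops_def)
    then have "path_class X (path_join (path_reverse p) p) = path_class X (\<lambda>_. x0)"
      using path_class_eq_iff path_homotopic_imp_pathin(1) by metis
    then show ?thesis
      using p r by (intro bexI[of _ "path_class X (path_reverse p)"])
        (auto simp: one mult_fundamental_group carrier)
  qed
qed


section \<open>Open covers and Spanier groups\<close>

definition open_cover :: "'a topology \<Rightarrow> 'a set set \<Rightarrow> bool" where
  "open_cover X \<U> \<longleftrightarrow> (\<forall>U\<in>\<U>. openin X U) \<and> \<Union>\<U> = topspace X"

definition cover_refines :: "'a set set \<Rightarrow> 'a set set \<Rightarrow> bool" where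
  "cover_refines \<V> \<U> \<longleftrightarrow> (\<forall>V\<in>\<V>. \<exists>U\<in>\<U>. V \<subseteq> U)"

definition paracompact_space :: "'a topology \<Rightarrow> bool" where
  "paracompact_space X \<longleftrightarrow>
     (\<forall>\<U>. open_cover X \<U> \<longrightarrow>
        (\<exists>\<V>. open_cover X \<V> \<and> cover_refines \<V> \<U> \<and> locally_finite_in X \<V>))"

definition spanier_group_cover :: "'a topology \<Rightarrow> 'a \<Rightarrow> 'a set set \<Rightarrow> (real \<Rightarrow> 'a) set set" where
  "spanier_group_cover X x0 \<U> =
     generate (fundamental_group X x0)
       {path_class X (path_join (path_join \<alpha> \<gamma>) (path_reverse \<alpha>)) | \<alpha> \<gamma>.
          pathin X \<alpha> \<and> \<alpha> 0 = x0 \<and> \<gamma> \<in> loops X (\<alpha> 1) \<and> (\<exists>U\<in>\<U>. \<gamma> ` {0..1} \<subseteq> U)}"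

definition spanier_group :: "'a topology \<Rightarrow> 'a \<Rightarrow> (real \<Rightarrow> 'a) set set" where
  "spanier_group X x0 = (\<Inter>\<U>\<in>{\<U>. open_cover X \<U>}. spanier_group_cover X x0 \<U>)"


section \<open>Geometric realization of an abstract simplicial complex\<close>

text \<open>
  A complex is given by its set of simplices (nonempty finite sets of vertices). Points of the
  realization are the functions of barycentric coordinates.
\<close>

definition closed_simplex :: "'v set \<Rightarrow> ('v \<Rightarrow> real) set" where
  "closed_simplex \<sigma> = {t. (\<forall>v. 0 \<le> t v) \<and> (\<forall>v. v \<notin> \<sigma> \<longrightarrow> t v = 0) \<and> sum t \<sigma> = 1}"

text \<open>
  The realization carries the weak topology: a set is open iff its trace on every closed
  simplex is open. On a closed simplex only finitely many coordinates are nonzero, so that the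
  product topology induces the Euclidean topology there.
\<close>

definition geometric_realization :: "'v set set \<Rightarrow> ('v \<Rightarrow> real) topology" where
  "geometric_realization K =
     topology (\<lambda>W. W \<subseteq> (\<Union>\<sigma>\<in>K. closed_simplex \<sigma>) \<and>
       (\<forall>\<sigma>\<in>K. openin (subtopology (powertop_real UNIV) (closed_simplex \<sigma>)) (W \<inter> closed_simplex \<sigma>)))"

lemma istopology_weak:
  "istopology (\<lambda>W. W \<subseteq> (\<Union>\<sigma>\<in>K. closed_simplex \<sigma>) \<and>
     (\<forall>\<sigma>\<in>K. openin (subtopology (powertop_real UNIV) (closed_simplex \<sigma>)) (W \<inter> closed_simplex \<sigma>)))"
  unfolding istopology_def
proof (intro conjI allI impI ballI; (elim conjE)?)
  fix S T \<sigma>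
  assume S: "\<forall>\<sigma>\<in>K. openin (subtopology (powertop_real UNIV) (closed_simplex \<sigma>)) (S \<inter> closed_simplex \<sigma>)"
    and T: "\<forall>\<sigma>\<in>K. openin (subtopology (powertop_real UNIV) (closed_simplex \<sigma>)) (T \<inter> closed_simplex \<sigma>)"
    and \<sigma>: "\<sigma> \<in> K"
  have "(S \<inter> T) \<inter> closed_simplex \<sigma> = (S \<inter> closed_simplex \<sigma>) \<inter> (T \<inter> closed_simplex \<sigma>)" by blast
  then show "openin (subtopology (powertop_real UNIV) (closed_simplex \<sigma>)) ((S \<inter> T) \<inter> closed_simplex \<sigma>)"
    using S T \<sigma> by (metis openin_Int)
next
  fix \<K> \<sigma>
  assume A: "\<forall>W\<in>\<K>. W \<subseteq> (\<Union>\<sigma>\<in>K. closed_simplex \<sigma>) \<and>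
     (\<forall>\<sigma>\<in>K. openin (subtopology (powertop_real UNIV) (closed_simplex \<sigma>)) (W \<inter> closed_simplex \<sigma>))"
    and \<sigma>: "\<sigma> \<in> K"
  have "\<Union>\<K> \<inter> closed_simplex \<sigma> = (\<Union>W\<in>\<K>. W \<inter> closed_simplex \<sigma>)" by blast
  moreover have "openin (subtopology (powertop_real UNIV) (closed_simplex \<sigma>)) (\<Union>W\<in>\<K>. W \<inter> closed_simplex \<sigma>)"
    by (rule openin_Union) (use A \<sigma> in blast)
  ultimately show "openin (subtopology (powertop_real UNIV) (closed_simplex \<sigma>)) (\<Union>\<K> \<inter> closed_simplex \<sigma>)"
    by metis
qed blast+

lemma openin_geometric_realization:
  "openin (geometric_realization K) W \<longleftrightarrow>
     W \<subseteq> (\<Union>\<sigma>\<in>K. closed_simplex \<sigma>) \<and>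
     (\<forall>\<sigma>\<in>K. openin (subtopology (powertop_real UNIV) (closed_simplex \<sigma>)) (W \<inter> closed_simplex \<sigma>))"
  unfolding geometric_realization_def topology_inverse'[OF istopology_weak] ..

lemma topspace_geometric_realization:
  "topspace (geometric_realization K) = (\<Union>\<sigma>\<in>K. closed_simplex \<sigma>)"
proof
  show "topspace (geometric_realization K) \<subseteq> (\<Union>\<sigma>\<in>K. closed_simplex \<sigma>)"
    using openin_topspace[of "geometric_realization K"] unfolding openin_geometric_realization by blast
  have "(\<Union>\<sigma>\<in>K. closed_simplex \<sigma>) \<inter> closed_simplex \<sigma> = closed_simplex \<sigma>" if "\<sigma> \<in> K" for \<sigma> :: "'a set"
    using that by blast
  then have "openin (geometric_realization K) (\<Union>\<sigma>\<in>K. closed_simplex \<sigma>)"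
    unfolding openin_geometric_realization by (simp add: openin_subtopology_refl)
  then show "(\<Union>\<sigma>\<in>K. closed_simplex \<sigma>) \<subseteq> topspace (geometric_realization K)"
    by (rule openin_subset)
qed

definition vertex_point :: "'v \<Rightarrow> 'v \<Rightarrow> real" where
  "vertex_point v = (\<lambda>w. if w = v then 1 else 0)"

definition open_star :: "'v set set \<Rightarrow> 'v \<Rightarrow> ('v \<Rightarrow> real) set" where
  "open_star K v = {t \<in> topspace (geometric_realization K). 0 < t v}"

text \<open>
  The affine extension of a vertex map \<open>f\<close>. The sums are finite on the realization.
\<close>

definition simplicial_realization :: "('v \<Rightarrow> 'w) \<Rightarrow> ('v \<Rightarrow> real) \<Rightarrow> 'w \<Rightarrow> real" where
  "simplicial_realization f t = (\<lambda>w. \<Sum>v | t v \<noteq> 0 \<and> f v = w. t v)"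

definition nerve :: "'a set set \<Rightarrow> 'a set set set" where
  "nerve \<U> = {\<sigma>. \<sigma> \<subseteq> \<U> \<and> finite \<sigma> \<and> \<sigma> \<noteq> {} \<and> \<Inter>\<sigma> \<noteq> {}}"


section \<open>The first shape group\<close>

type_synonym 'a pointed_cover = "'a set set \<times> 'a set"

definition partition_of_unity :: "'a topology \<Rightarrow> 'a set set \<Rightarrow> ('a set \<Rightarrow> 'a \<Rightarrow> real) \<Rightarrow> bool" where
  "partition_of_unity X \<U> \<phi> \<longleftrightarrow>
     (\<forall>U\<in>\<U>. continuous_map X euclideanreal (\<phi> U) \<and> (\<forall>x\<in>topspace X. 0 \<le> \<phi> U x) \<and>
             X closure_of {x \<in> topspace X. \<phi> U x \<noteq> 0} \<subseteq> U) \<and>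
     (\<forall>x\<in>topspace X. \<exists>V. openin X V \<and> x \<in> V \<and> finite {U \<in> \<U>. \<exists>y\<in>V. \<phi> U y \<noteq> 0}) \<and>
     (\<forall>x\<in>topspace X. (\<Sum>U | U \<in> \<U> \<and> \<phi> U x \<noteq> 0. \<phi> U x) = 1)"

definition normal_pointed_covers :: "'a topology \<Rightarrow> 'a \<Rightarrow> 'a pointed_cover set" where
  "normal_pointed_covers X x0 =
     {(\<U>, U0). open_cover X \<U> \<and> U0 \<in> \<U> \<and> x0 \<in> U0 \<and>
        (\<exists>\<phi>. partition_of_unity X \<U> \<phi> \<and> \<phi> U0 x0 = 1)}"

definition pointed_refines :: "'a pointed_cover \<Rightarrow> 'a pointed_cover \<Rightarrow> bool" where
  "pointed_refines d c \<longleftrightarrow> cover_refines (fst d) (fst c) \<and> snd d \<subseteq> snd c"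

definition nerve_space :: "'a pointed_cover \<Rightarrow> ('a set \<Rightarrow> real) topology" where
  "nerve_space c = geometric_realization (nerve (fst c))"

definition nerve_pi1 :: "'a pointed_cover \<Rightarrow> (real \<Rightarrow> 'a set \<Rightarrow> real) set monoid" where
  "nerve_pi1 c = fundamental_group (nerve_space c) (vertex_point (snd c))"

definition vertex_assignment :: "'a pointed_cover \<Rightarrow> 'a pointed_cover \<Rightarrow> ('a set \<Rightarrow> 'a set) \<Rightarrow> bool" where
  "vertex_assignment d c f \<longleftrightarrow> (\<forall>V\<in>fst d. f V \<in> fst c \<and> V \<subseteq> f V) \<and> f (snd d) = snd c"

text \<open>
  The choices of a vertex assignment here and of a canonical map below do not affect the
  induced homomorphisms, since both are unique up to based homotopy.
\<close>

definition bonding_map ::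
  "'a pointed_cover \<Rightarrow> 'a pointed_cover \<Rightarrow> (real \<Rightarrow> 'a set \<Rightarrow> real) set \<Rightarrow> (real \<Rightarrow> 'a set \<Rightarrow> real) set"
  where
  "bonding_map c d =
     induced_map (nerve_space c) (simplicial_realization (SOME f. vertex_assignment d c f))"

definition shape_group ::
  "'a topology \<Rightarrow> 'a \<Rightarrow> ('a pointed_cover \<Rightarrow> (real \<Rightarrow> 'a set \<Rightarrow> real) set) monoid" where
  "shape_group X x0 =
     (product_group (normal_pointed_covers X x0) nerve_pi1)
       \<lparr>carrier := {g \<in> carrier (product_group (normal_pointed_covers X x0) nerve_pi1).
          \<forall>c\<in>normal_pointed_covers X x0. \<forall>d\<in>normal_pointed_covers X x0.
            pointed_refines d c \<longrightarrow> bonding_map c d (g d) = g c}\<rparr>"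

definition canonical_map :: "'a topology \<Rightarrow> 'a \<Rightarrow> 'a pointed_cover \<Rightarrow> ('a \<Rightarrow> 'a set \<Rightarrow> real) \<Rightarrow> bool" where
  "canonical_map X x0 c p \<longleftrightarrow>
     continuous_map X (nerve_space c) p \<and> p x0 = vertex_point (snd c) \<and>
     (\<forall>U\<in>fst c. {x \<in> topspace X. p x \<in> open_star (nerve (fst c)) U} \<subseteq> U)"

definition shape_map ::
  "'a topology \<Rightarrow> 'a \<Rightarrow> (real \<Rightarrow> 'a) set \<Rightarrow> 'a pointed_cover \<Rightarrow> (real \<Rightarrow> 'a set \<Rightarrow> real) set" where
  "shape_map X x0 A =
     (\<lambda>c\<in>normal_pointed_covers X x0.
        induced_map (nerve_space c) (SOME p. canonical_map X x0 c p) A)"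

definition pi1_shape_injective :: "'a topology \<Rightarrow> 'a \<Rightarrow> bool" where
  "pi1_shape_injective X x0 \<longleftrightarrow>
     kernel (fundamental_group X x0) (shape_group X x0) (shape_map X x0) =
       {\<one>\<^bsub>fundamental_group X x0\<^esub>}"

end

theory Submission
  imports Defs
begin

text \<open>
  In fact \<open>ker \<Psi>\<^sub>X = \<pi>\<^sup>S\<^sup>p(X, x\<^sub>0)\<close>. A canonical map \<open>p\<close> sends loops in the open set \<open>p\<^sup>-\<^sup>1(St U)\<close> into a
  contractible star, so it kills the Spanier group of the cover by these sets.

  Conversely let \<open>\<U>\<close> be an open cover and \<open>Q\<close> the quotient of \<open>\<pi>\<^sub>1(X, x\<^sub>0)\<close> by the normal subgroup
  \<open>\<pi>\<^sup>S\<^sup>p(\<U>, x\<^sub>0)\<close>. Choosing paths from \<open>x\<^sub>0\<close> to all points turns every path of \<open>X\<close> into an element of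
  \<open>Q\<close>, and loops in members of \<open>\<U>\<close> become trivial. Take a normal cover \<open>\<V>\<close> whose members lie in
  path connected open sets \<open>P V\<close> such that \<open>P V \<union> P V'\<close> is contained in a member of \<open>\<U>\<close> whenever \<open>P V\<close>
  and \<open>P V'\<close> meet. Paths inside \<open>P V \<union> P V'\<close> then define a \<open>Q\<close>-valued 1-cocycle on the nerve of \<open>\<V>\<close>,
  whose holonomy along \<open>p \<circ> \<alpha>\<close> is the class of \<open>\<alpha>\<close>. If \<open>p \<circ> \<alpha>\<close> is null-homotopic, the pull-back of
  the cocycle to the square has a parallel section, so this class is trivial. In this way simplicial
  approximation is avoided.
\<close>

(* HOL-Algebra's closure_of clashes with the topological one. *)
no_notation eq_closure_of (\<open>closure'_of\<index>\<close>)

subsection \<open>Paths\<close>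

text \<open>A null-homotopy of \<open>p \<circ> \<alpha>\<close> runs through points of the nerve
  that come from no point of \<open>X\<close>, so no path of \<open>X\<close> can be followed along
  it. What can be followed is data that depends on vertices alone: the element \<open>g u v\<close>
  is read off at any common point of \<open>P u\<close> and \<open>P v\<close>, and the cocycle
  identity needs only one point common to three charts, which a simplex of the nerve guarantees. Two
  paths with the same ends, one in \<open>P u\<close> and one in \<open>P v\<close>, form a loop in
  \<open>P u \<union> P v\<close> that has to die in \<open>Q\<close>; this is why unions of two
  meeting members must fit into one member of \<open>\<U>\<close>, and why a barycentric refinement
  is taken. Members of a normal cover may fail to be path connected, hence the larger sets
  \<open>P V\<close>. On three sides of the square the homotopy rests at the base vertex, so the
  parallel section has equal values at both ends of \<open>\<alpha>\<close>. The shape map is built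
  from canonical maps picked by \<open>SOME\<close>; both inclusions use only the defining
  properties of a canonical map, so they hold for whichever one is picked.\<close>

lemma path_class_eqI: "path_homotopic X p q \<Longrightarrow> path_class X p = path_class X q"
  using path_class_eq_iff path_homotopic_imp_pathin(1) by metis

lemma path_join_ends [simp]: "path_join p q 0 = p 0" "path_join p q 1 = q 1"
  by (simp_all add: path_join_def)

lemma path_reverse_ends [simp]: "path_reverse p 0 = p 1" "path_reverse p 1 = p 0"
  by (simp_all add: path_reverse_def)

lemma pathin_in_topspace: "pathin X p \<Longrightarrow> t \<in> {0..1} \<Longrightarrow> p t \<in> topspace X"
  by (auto simp: pathin_def continuous_map_def)

lemma path_join_reverse_cancel:
  assumes p: "pathin X p" and q: "pathin X q" and pq: "p 1 = q 0"
  shows "path_homotopic X (path_join (path_reverse p) (path_join p q)) q"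
proof -
  have "path_homotopic X (path_join (path_reverse p) (path_join p q)) (path_join (path_join (path_reverse p) p) q)"
    by (rule path_homotopic_sym, rule path_join_assoc) (use p q pq pathin_reverse in auto)
  moreover have "path_homotopic X (path_join (path_join (path_reverse p) p) q) (path_join (\<lambda>_. q 0) q)"
    using path_join_reverse_left[OF p] q pq by (intro path_homotopic_join path_homotopic_refl) auto
  moreover note path_join_const_left[OF q]
  ultimately show ?thesis by (meson path_homotopic_trans)
qed

lemma path_join_const_right:
  assumes "pathin X p"
  shows "path_homotopic X (path_join p (\<lambda>_. p 1)) p"
  by (rule path_homotopic_reparam[where P = p and \<psi> = "\<lambda>t. t" and \<phi> = "\<lambda>t. min 1 (2 * t)"])
     (use assms in \<open>auto intro!: continuous_intros simp: path_join_def min.absorb1 min.absorb2\<close>)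

lemma path_join_reverse_right:
  assumes "pathin X p"
  shows "path_homotopic X (path_join p (path_reverse p)) (\<lambda>_. p 0)"
  by (rule path_homotopic_reparam[where P = p and \<psi> = "\<lambda>t. 0" and \<phi> = "\<lambda>t. 1 - \<bar>2 * t - 1\<bar>"])
     (use assms in \<open>auto intro!: continuous_intros simp: path_join_def path_reverse_def algebra_simps\<close>)

lemma comp_path_join: "f \<circ> path_join p q = path_join (f \<circ> p) (f \<circ> q)"
  by (auto simp: path_join_def fun_eq_iff)

lemma comp_path_reverse: "f \<circ> path_reverse p = path_reverse (f \<circ> p)"
  by (auto simp: path_reverse_def fun_eq_iff)

lemma path_conjugate_null:
  assumes \<alpha>: "pathin Y \<alpha>" and \<gamma>: "path_homotopic Y \<gamma> (\<lambda>_. \<alpha> 1)"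
  shows "path_homotopic Y (path_join (path_join \<alpha> \<gamma>) (path_reverse \<alpha>)) (\<lambda>_. \<alpha> 0)"
proof -
  have ends: "\<gamma> 0 = \<alpha> 1" "\<gamma> 1 = \<alpha> 1" using path_homotopic_ends[OF \<gamma>] by simp_all
  have 1: "path_homotopic Y (path_join \<alpha> \<gamma>) \<alpha>"
    by (rule path_homotopic_trans[OF path_homotopic_join[OF path_homotopic_refl[OF \<alpha>] \<gamma>] path_join_const_right[OF \<alpha>]])
      (simp add: ends)
  have "path_homotopic Y (path_join (path_join \<alpha> \<gamma>) (path_reverse \<alpha>)) (path_join \<alpha> (path_reverse \<alpha>))"
    by (rule path_homotopic_join[OF 1 path_homotopic_refl[OF pathin_reverse[OF \<alpha>]]]) (simp add: ends)
  from path_homotopic_trans[OF this path_join_reverse_right[OF \<alpha>]] show ?thesis .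
qed

lemma induced_map_hom:
  assumes f: "continuous_map X Y f"
  shows "induced_map Y f \<in> hom (fundamental_group X x0) (fundamental_group Y (f x0))"
proof (rule homI)
  have loop: "f \<circ> p \<in> loops Y (f x0)" if "p \<in> loops X x0" for p
    using that f by (auto simp: loops_def pathin_def intro: continuous_map_compose)
  have cls: "induced_map Y f (path_class X p) = path_class Y (f \<circ> p)" if "p \<in> loops X x0" for p
    by (rule induced_map_path_class[OF _ f]) (use that in \<open>simp add: loops_def\<close>)
  fix A assume "A \<in> carrier (fundamental_group X x0)"
  then obtain p where p: "p \<in> loops X x0" "A = path_class X p" by (auto simp: fundamental_group_def)
  show "induced_map Y f A \<in> carrier (fundamental_group Y (f x0))"
    using p cls loop by (simp add: fundamental_group_def)
  fix B assume "B \<in> carrier (fundamental_group X x0)"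
  then obtain q where q: "q \<in> loops X x0" "B = path_class X q" by (auto simp: fundamental_group_def)
  show "induced_map Y f (A \<otimes>\<^bsub>fundamental_group X x0\<^esub> B) =
      induced_map Y f A \<otimes>\<^bsub>fundamental_group Y (f x0)\<^esub> induced_map Y f B"
    using p q loop by (simp add: mult_fundamental_group loops_join cls comp_path_join)
qed

text \<open>The counterpart of \<open>subpath\<close> for abstract topologies;
  \<open>path_segment 0 1 p\<close> is \<open>p\<close> itself.\<close>

definition path_segment :: "real \<Rightarrow> real \<Rightarrow> (real \<Rightarrow> 'a) \<Rightarrow> real \<Rightarrow> 'a" where
  "path_segment a b p = (\<lambda>t. p ((b - a) * t + a))"

lemma pathin_path_segment:
  assumes "pathin X p" "a \<in> {0..1}" "b \<in> {0..1}" shows "pathin X (path_segment a b p)"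
proof -
  have "(\<lambda>t. (b - a) * t + a) ` {0..1} \<subseteq> {0..1}"
  proof (rule image_subsetI)
    fix t :: real assume t: "t \<in> {0..1}"
    have "(b - a) * t + a = (1 - t) * a + t * b" by (simp add: algebra_simps)
    moreover have "(1 - t) * a + t * b \<in> {0..1}"
      using t assms(2,3) convexD[of "{0..1::real}" a b "1 - t" t] by simp
    ultimately show "(b - a) * t + a \<in> {0..1}" by simp
  qed
  then have "continuous_map (top_of_set {0..1}) (top_of_set {0..1}) (\<lambda>t. (b - a) * t + a)"
    by (auto intro!: continuous_intros)
  from continuous_map_compose[OF this assms(1)[unfolded pathin_def]] show ?thesis
    by (simp add: pathin_def path_segment_def o_def)
qed

lemma path_segment_image:
  assumes "a \<le> b" "t \<in> {0..1}" shows "\<exists>s\<in>{a..b}. path_segment a b p t = p s"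
proof (rule bexI[of _ "(b - a) * t + a"])
  show "(b - a) * t + a \<in> {a..b}"
    using assms mult_left_le[of t "b - a"] by auto
qed (simp add: path_segment_def)

lemma path_homotopic_join_path_segment:
  assumes p: "pathin X p" and abc: "0 \<le> a" "a \<le> b" "b \<le> c" "c \<le> 1"
  shows "path_homotopic X (path_join (path_segment a b p) (path_segment b c p)) (path_segment a c p)"
proof (rule path_homotopic_reparam[OF p])
  \<comment> \<open>The clamped terms give one formula for both halves: the first stops growing at
    \<open>t = 1/2\<close>, where the second starts.\<close>
  let ?\<phi> = "\<lambda>t::real. (b - a) * min 1 (2 * t) + a + (c - b) * max 0 (2 * t - 1)"
  show "continuous_on {0..1} ?\<phi>" by (intro continuous_intros)
  show "continuous_on {0..1} (\<lambda>t. (c - a) * t + a)" by (intro continuous_intros)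
  have mult: "0 \<le> (d - e) * s" "(d - e) * s \<le> d - e" if "e \<le> d" "0 \<le> s" "s \<le> 1" for d e s :: real
    using that mult_left_le[of s "d - e"] by (simp_all add: mult.commute)
  show "?\<phi> ` {0..1} \<subseteq> {0..1}"
  proof (rule image_subsetI)
    fix t :: real assume "t \<in> {0..1}"
    then show "?\<phi> t \<in> {0..1}"
      using mult[OF abc(2), of "min 1 (2 * t)"] mult[OF abc(3), of "max 0 (2 * t - 1)"] abc by auto
  qed
  show "(\<lambda>t. (c - a) * t + a) ` {0..1} \<subseteq> {0..1}"
  proof (rule image_subsetI)
    fix t :: real assume "t \<in> {0..1}"
    then show "(c - a) * t + a \<in> {0..1}" using mult[of a c t] abc by auto
  qed
  show "path_join (path_segment a b p) (path_segment b c p) t = p (?\<phi> t)" for t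
    by (cases "t \<le> 1/2") (auto simp: path_join_def path_segment_def min.absorb1 min.absorb2 max.absorb1 max.absorb2 add.commute)
  show "path_segment a c p t = p ((c - a) * t + a)" for t by (simp add: path_segment_def)
qed auto

subsection \<open>Paracompact Hausdorff spaces\<close>

lemma paracompact_spaceD:
  assumes "paracompact_space X" "open_cover X \<U>"
  obtains \<V> where "open_cover X \<V>" "cover_refines \<V> \<U>" "locally_finite_in X \<V>"
  using assms unfolding paracompact_space_def by blast

lemma open_coverD:
  assumes "open_cover X \<U>"
  shows "\<And>U. U \<in> \<U> \<Longrightarrow> openin X U" "\<And>U. U \<in> \<U> \<Longrightarrow> U \<subseteq> topspace X" "\<Union>\<U> = topspace X"
  using assms openin_subset unfolding open_cover_def by blast+

text \<open>The common core of regularity and normality. The given neighbourhoods together with the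
  complement of \<open>C\<close> cover \<open>X\<close>; in a locally finite refinement every member
  that meets \<open>C\<close> lies in some \<open>V y\<close>, so its closure misses
  \<open>B\<close>. Local finiteness lets the closure pass through the union of these
  members.\<close>

lemma paracompact_separate_closed:
  assumes X: "paracompact_space X" and C: "closedin X C"
    and sep: "\<And>y. y \<in> C \<Longrightarrow> \<exists>V. openin X V \<and> y \<in> V \<and> disjnt B (X closure_of V)"
  obtains W where "openin X W" "C \<subseteq> W" "disjnt B (X closure_of W)"
proof -
  obtain V where V: "\<And>y. y \<in> C \<Longrightarrow> openin X (V y) \<and> y \<in> V y \<and> disjnt B (X closure_of V y)"
    using sep by metis
  have "open_cover X (insert (topspace X - C) (V ` C))"
    using C V closedin_subset[OF C] unfolding open_cover_def
    by (auto dest: openin_subset)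
  then obtain \<O> where \<O>: "open_cover X \<O>" "cover_refines \<O> (insert (topspace X - C) (V ` C))"
      "locally_finite_in X \<O>"
    using paracompact_spaceD[OF X] by metis
  define \<O>' where "\<O>' = {U \<in> \<O>. U \<inter> C \<noteq> {}}"
  have lf: "locally_finite_in X \<O>'"
    using \<O>(3) by (rule locally_finite_in_subset) (auto simp: \<O>'_def)
  have "disjnt B (X closure_of U)" if U: "U \<in> \<O>'" for U
  proof -
    have "\<exists>y\<in>C. U \<subseteq> V y"
      using U \<O>(2) unfolding \<O>'_def cover_refines_def by blast
    then obtain y where "y \<in> C" "U \<subseteq> V y" by blast
    then show ?thesis using V closure_of_mono[of U "V y" X] by (meson disjnt_subset2)
  qed
  then have "disjnt B (X closure_of \<Union>\<O>')"
    unfolding closure_of_locally_finite_Union[OF lf] by (auto simp: disjnt_iff)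
  moreover have "openin X (\<Union>\<O>')" using open_coverD(1)[OF \<O>(1)] by (auto simp: \<O>'_def)
  moreover have "C \<subseteq> \<Union>\<O>'"
    using open_coverD(3)[OF \<O>(1)] closedin_subset[OF C] unfolding \<O>'_def by blast
  ultimately show thesis using that by blast
qed

lemma paracompact_Hausdorff_imp_regular:
  assumes X: "paracompact_space X" "Hausdorff_space X"
  shows "regular_space X"
  unfolding regular_space_def
proof (intro allI impI, elim conjE)
  fix C a assume C: "closedin X C" and a: "a \<in> topspace X - C"
  have "\<exists>V. openin X V \<and> y \<in> V \<and> disjnt {a} (X closure_of V)" if "y \<in> C" for y
  proof -
    have "y \<in> topspace X" "y \<noteq> a" using C a that closedin_subset by blast+
    then obtain U V where UV: "openin X U" "openin X V" "a \<in> U" "y \<in> V" "disjnt U V"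
      using X(2) a unfolding Hausdorff_space_def by (metis DiffD1)
    then have "disjnt U (X closure_of V)"
      by (simp add: disjnt_def openin_Int_closure_of_eq_empty)
    then show ?thesis using UV by (auto simp: disjnt_iff)
  qed
  then obtain W where W: "openin X W" "C \<subseteq> W" "disjnt {a} (X closure_of W)"
    using paracompact_separate_closed[OF X(1) C] by metis
  show "\<exists>U V. openin X U \<and> openin X V \<and> a \<in> U \<and> C \<subseteq> V \<and> disjnt U V"
  proof (intro exI conjI)
    show "openin X (topspace X - X closure_of W)" by (simp add: openin_diff)
    show "disjnt (topspace X - X closure_of W) W"
      using closure_of_subset[OF openin_subset[OF W(1)]] by (auto simp: disjnt_iff)
  qed (use W a in \<open>auto simp: disjnt_iff\<close>)
qed

lemma paracompact_Hausdorff_imp_normal: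
  assumes X: "paracompact_space X" "Hausdorff_space X"
  shows "normal_space X"
  unfolding normal_space_def
proof (intro allI impI, elim conjE)
  fix B C assume B: "closedin X B" and C: "closedin X C" and BC: "disjnt B C"
  have "\<exists>V. openin X V \<and> y \<in> V \<and> disjnt B (X closure_of V)" if "y \<in> C" for y
  proof -
    have "y \<in> topspace X - B" using that BC closedin_subset[OF C] by (auto simp: disjnt_iff)
    then show ?thesis
      using paracompact_Hausdorff_imp_regular[OF X] B unfolding regular_space by blast
  qed
  then obtain W where W: "openin X W" "C \<subseteq> W" "disjnt B (X closure_of W)"
    using paracompact_separate_closed[OF X(1) C] by metis
  show "\<exists>U V. openin X U \<and> openin X V \<and> B \<subseteq> U \<and> C \<subseteq> V \<and> disjnt U V"
  proof (intro exI conjI)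
    show "openin X (topspace X - X closure_of W)" by (simp add: openin_diff)
    show "disjnt (topspace X - X closure_of W) W"
      using closure_of_subset[OF openin_subset[OF W(1)]] by (auto simp: disjnt_iff)
  qed (use W closedin_subset[OF B] in \<open>auto simp: disjnt_iff\<close>)
qed

text \<open>By regularity the open sets whose closure lies in some member of \<open>\<W>\<close>
  cover \<open>X\<close>. Each member of a locally finite refinement is assigned to one
  \<open>W\<close> containing its closure, and \<open>F W\<close> is the closure of the union of
  those assigned to \<open>W\<close>. As closures commute with locally finite unions,
  \<open>F W\<close> stays inside \<open>W\<close>.\<close>

lemma closed_shrinking:
  assumes X: "paracompact_space X" "Hausdorff_space X" and \<W>: "open_cover X \<W>"
  obtains F where "\<And>W. W \<in> \<W> \<Longrightarrow> closedin X (F W)" "\<And>W. W \<in> \<W> \<Longrightarrow> F W \<subseteq> W"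
    "(\<Union>W\<in>\<W>. F W) = topspace X"
proof -
  define \<N> where "\<N> = {N. openin X N \<and> (\<exists>W\<in>\<W>. X closure_of N \<subseteq> W)}"
  have "\<exists>N\<in>\<N>. x \<in> N" if x: "x \<in> topspace X" for x
  proof -
    obtain W where W: "W \<in> \<W>" "x \<in> W" using x open_coverD(3)[OF \<W>] by blast
    then have "closedin X (topspace X - W)" "x \<in> topspace X - (topspace X - W)"
      using x open_coverD(1)[OF \<W>] by auto
    then obtain U where U: "openin X U" "x \<in> U" "disjnt (topspace X - W) (X closure_of U)"
      using paracompact_Hausdorff_imp_regular[OF X] unfolding regular_space by blast
    then have "X closure_of U \<subseteq> W"
      using closure_of_subset_topspace[of X U] by (auto simp: disjnt_iff)
    with U W show ?thesis by (auto simp: \<N>_def)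
  qed
  then have "open_cover X \<N>"
    unfolding open_cover_def by (auto simp: \<N>_def dest: openin_subset)
  then obtain \<O> where \<O>: "open_cover X \<O>" "cover_refines \<O> \<N>" "locally_finite_in X \<O>"
    using paracompact_spaceD[OF X(1)] by metis
  have "\<exists>W\<in>\<W>. X closure_of U \<subseteq> W" if U: "U \<in> \<O>" for U
  proof -
    obtain N where "N \<in> \<N>" "U \<subseteq> N" using U \<O>(2) unfolding cover_refines_def by blast
    then show ?thesis using closure_of_mono[of U N X] unfolding \<N>_def by blast
  qed
  then obtain f where f: "\<And>U. U \<in> \<O> \<Longrightarrow> f U \<in> \<W>" "\<And>U. U \<in> \<O> \<Longrightarrow> X closure_of U \<subseteq> f U"
    by metis
  define F where "F W = X closure_of (\<Union>{U \<in> \<O>. f U = W})" for W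
  have lf: "locally_finite_in X {U \<in> \<O>. f U = W}" for W
    using \<O>(3) by (rule locally_finite_in_subset) auto
  have F_eq: "F W = (\<Union>U\<in>{U \<in> \<O>. f U = W}. X closure_of U)" for W
    unfolding F_def closure_of_locally_finite_Union[OF lf] ..
  show thesis
  proof
    show "closedin X (F W)" for W by (simp add: F_def)
    show FW: "F W \<subseteq> W" for W unfolding F_eq using f(2) by blast
    have "x \<in> (\<Union>W\<in>\<W>. F W)" if "x \<in> topspace X" for x
    proof -
      obtain U where U: "U \<in> \<O>" "x \<in> U" using open_coverD(3)[OF \<O>(1)] \<open>x \<in> topspace X\<close> by blast
      then have "x \<in> X closure_of U" using closure_of_subset[of U X] open_coverD(2)[OF \<O>(1) U(1)] by blast
      then have "x \<in> F (f U)" using U(1) unfolding F_eq by blast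
      then show ?thesis using f(1)[OF U(1)] by blast
    qed
    moreover have "F W \<subseteq> topspace X" for W unfolding F_def by (rule closure_of_subset_topspace)
    ultimately show "(\<Union>W\<in>\<W>. F W) = topspace X" by blast
  qed
qed

text \<open>The set that absorbs all members through \<open>y\<close> is chosen from
  \<open>y\<close> alone: any \<open>W\<close> with \<open>y \<in> F W\<close>. If
  \<open>y \<in> N x\<close>, then \<open>x \<in> F W\<close>, for otherwise \<open>F W\<close>
  would have been removed from \<open>N x\<close>; hence \<open>N x \<subseteq> W\<close>.\<close>

lemma barycentric_refinement:
  assumes X: "paracompact_space X" "Hausdorff_space X" and \<U>: "open_cover X \<U>"
  obtains \<V> where "open_cover X \<V>"
    "\<And>x. x \<in> topspace X \<Longrightarrow> \<exists>U\<in>\<U>. \<Union>{V \<in> \<V>. x \<in> V} \<subseteq> U"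
proof -
  obtain \<W> where \<W>: "open_cover X \<W>" "cover_refines \<W> \<U>" "locally_finite_in X \<W>"
    using paracompact_spaceD[OF X(1) \<U>] by metis
  obtain F where F: "\<And>W. W \<in> \<W> \<Longrightarrow> closedin X (F W)" "\<And>W. W \<in> \<W> \<Longrightarrow> F W \<subseteq> W"
    "(\<Union>W\<in>\<W>. F W) = topspace X" using closed_shrinking[OF X \<W>(1)] by metis
  define N where "N x = topspace X \<inter> \<Inter>{W \<in> \<W>. x \<in> F W} - \<Union>(F ` {W \<in> \<W>. x \<notin> F W})" for x
  have fin: "finite {W \<in> \<W>. x \<in> F W}" if x: "x \<in> topspace X" for x
  proof -
    obtain V where "x \<in> V" "finite {U \<in> \<W>. U \<inter> V \<noteq> {}}"
      using \<W>(3) x unfolding locally_finite_in_def by blast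
    then show ?thesis by (elim rev_finite_subset) (use F(2) in blast)
  qed
  have "openin X (N x)" if x: "x \<in> topspace X" for x
  proof -
    \<comment> \<open>Infinitely many sets \<open>F W\<close> may be removed; local finiteness keeps
      their union closed.\<close>
    have "closedin X (\<Union>(F ` {W \<in> \<W>. x \<notin> F W}))"
    proof (rule closedin_locally_finite_Union)
      show "locally_finite_in X (F ` {W \<in> \<W>. x \<notin> F W})"
        using F(2) by (intro locally_finite_in_refinement locally_finite_in_subset[OF \<W>(3)]) auto
    qed (use F(1) in auto)
    moreover have "openin X (topspace X \<inter> \<Inter>{W \<in> \<W>. x \<in> F W})"
    proof (cases "{W \<in> \<W>. x \<in> F W} = {}")
      case True then show ?thesis unfolding True by simp
    next
      case False
      with fin[OF x] open_coverD(1)[OF \<W>(1)] show ?thesis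
        by (intro openin_Int openin_Inter) auto
    qed
    ultimately show ?thesis unfolding N_def by (rule openin_diff[rotated])
  qed
  moreover have "x \<in> N x" if "x \<in> topspace X" for x
    using that F(2) by (auto simp: N_def)
  ultimately have "open_cover X (N ` topspace X)"
    unfolding open_cover_def using openin_subset by blast
  moreover have "\<exists>U\<in>\<U>. \<Union>{V \<in> N ` topspace X. y \<in> V} \<subseteq> U" if y: "y \<in> topspace X" for y
  proof -
    obtain W where W: "W \<in> \<W>" "y \<in> F W" using F(3) y by blast
    have "N x \<subseteq> W" if "y \<in> N x" for x
    proof -
      have "x \<in> F W" using W that unfolding N_def by blast
      then show ?thesis using W unfolding N_def by blast
    qed
    then have "\<Union>{V \<in> N ` topspace X. y \<in> V} \<subseteq> W" by blast
    then show ?thesis using W(1) \<W>(2) unfolding cover_refines_def by (meson subset_trans)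
  qed
  ultimately show thesis using that by blast
qed

lemma partition_of_unity_exists:
  assumes X: "paracompact_space X" "Hausdorff_space X"
    and \<W>: "open_cover X \<W>" "locally_finite_in X \<W>"
  obtains \<phi> where "partition_of_unity X \<W> \<phi>"
proof -
  obtain F where F: "\<And>W. W \<in> \<W> \<Longrightarrow> closedin X (F W)" "\<And>W. W \<in> \<W> \<Longrightarrow> F W \<subseteq> W"
    "(\<Union>W\<in>\<W>. F W) = topspace X" using closed_shrinking[OF X \<W>(1)] by metis
  have nX: "normal_space X" using paracompact_Hausdorff_imp_normal[OF X] .
  have "\<forall>W\<in>\<W>. \<exists>g. continuous_map X euclideanreal g \<and> (\<forall>x\<in>topspace X. 0 \<le> g x) \<and> (\<forall>x\<in>F W. g x = 1) \<and>
      X closure_of {x \<in> topspace X. g x \<noteq> 0} \<subseteq> W"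
  proof
    fix W assume W: "W \<in> \<W>"
    \<comment> \<open>The function is cut off at \<open>G\<close> rather than at \<open>W\<close>,
      because the closure of its support has to lie in \<open>W\<close>.\<close>
    obtain G where G: "openin X G" "F W \<subseteq> G" "X closure_of G \<subseteq> W"
      using nX F(1,2)[OF W] open_coverD(1)[OF \<W>(1) W] unfolding normal_space_alt by metis
    then have "closedin X (topspace X - G)" "disjnt (topspace X - G) (F W)"
      by (auto simp: disjnt_iff)
    then obtain g where g: "continuous_map X (top_of_set {0..1::real}) g"
        "g ` (topspace X - G) \<subseteq> {0}" "g ` F W \<subseteq> {1}"
      using Urysohn_lemma[OF nX _ F(1)[OF W], of "topspace X - G" 0 1] by auto
    have "{x \<in> topspace X. g x \<noteq> 0} \<subseteq> G" using g(2) by auto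
    then have "X closure_of {x \<in> topspace X. g x \<noteq> 0} \<subseteq> W"
      using G(3) closure_of_mono by blast
    then show "\<exists>g. continuous_map X euclideanreal g \<and> (\<forall>x\<in>topspace X. 0 \<le> g x) \<and> (\<forall>x\<in>F W. g x = 1) \<and>
      X closure_of {x \<in> topspace X. g x \<noteq> 0} \<subseteq> W"
      using g unfolding continuous_map_in_subtopology
      by (intro exI[of _ g]) (auto simp: Pi_iff)
  qed
  from bchoice[OF this] obtain g where g: "\<And>W. W \<in> \<W> \<Longrightarrow> continuous_map X euclideanreal (g W)"
      "\<And>W x. W \<in> \<W> \<Longrightarrow> x \<in> topspace X \<Longrightarrow> 0 \<le> g W x"
      "\<And>W x. W \<in> \<W> \<Longrightarrow> x \<in> F W \<Longrightarrow> g W x = 1"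
      "\<And>W. W \<in> \<W> \<Longrightarrow> X closure_of {x \<in> topspace X. g W x \<noteq> 0} \<subseteq> W"
    by blast
  have g0: "x \<in> W" if "W \<in> \<W>" "x \<in> topspace X" "g W x \<noteq> 0" for W x
    using g(4)[OF that(1)] that closure_of_subset[of "{x \<in> topspace X. g W x \<noteq> 0}" X] by blast
  define s where "s x = (\<Sum>W | W \<in> \<W> \<and> g W x \<noteq> 0. g W x)" for x
  have nbhd: "\<exists>V. openin X V \<and> x \<in> V \<and> finite {W \<in> \<W>. \<exists>y\<in>V. g W y \<noteq> 0}"
    if x: "x \<in> topspace X" for x
  proof -
    obtain V where V: "openin X V" "x \<in> V" "finite {U \<in> \<W>. U \<inter> V \<noteq> {}}"
      using \<W>(2) x unfolding locally_finite_in_def by blast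
    have "{W \<in> \<W>. \<exists>y\<in>V. g W y \<noteq> 0} \<subseteq> {U \<in> \<W>. U \<inter> V \<noteq> {}}"
      using g0 openin_subset[OF V(1)] by blast
    then show ?thesis using V finite_subset by blast
  qed
  have fin: "finite {W \<in> \<W>. g W x \<noteq> 0}" if x: "x \<in> topspace X" for x
  proof -
    obtain V where "x \<in> V" "finite {W \<in> \<W>. \<exists>y\<in>V. g W y \<noteq> 0}" using nbhd[OF x] by blast
    then show ?thesis by (elim rev_finite_subset) blast
  qed
  \<comment> \<open>Locally \<open>s\<close> is a sum over a fixed finite index set. The pieces to
    be pasted are the open sets on which only finitely many \<open>g W\<close> are nonzero.\<close>
  have cs: "continuous_map X euclideanreal s"
  proof (rule pasting_lemma[where T = id and I = "{V. openin X V \<and> finite {W \<in> \<W>. \<exists>y\<in>V. g W y \<noteq> 0}}"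
        and f = "\<lambda>V x. \<Sum>W | W \<in> \<W> \<and> (\<exists>y\<in>V. g W y \<noteq> 0). g W x"])
    have eq: "(\<Sum>W | W \<in> \<W> \<and> (\<exists>y\<in>V. g W y \<noteq> 0). g W x) = s x"
      if "finite {W \<in> \<W>. \<exists>y\<in>V. g W y \<noteq> 0}" "x \<in> V" for V x
      unfolding s_def by (rule sum.mono_neutral_right) (use that in auto)
    show "continuous_map (subtopology X (id V)) euclideanreal (\<lambda>x. \<Sum>W | W \<in> \<W> \<and> (\<exists>y\<in>V. g W y \<noteq> 0). g W x)"
      if "V \<in> {V. openin X V \<and> finite {W \<in> \<W>. \<exists>y\<in>V. g W y \<noteq> 0}}" for V
      using that g(1) by (intro continuous_map_sum continuous_map_from_subtopology) auto
    show "(\<Sum>W | W \<in> \<W> \<and> (\<exists>y\<in>V. g W y \<noteq> 0). g W x) = (\<Sum>W | W \<in> \<W> \<and> (\<exists>y\<in>V'. g W y \<noteq> 0). g W x)"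
      if "V \<in> {V. openin X V \<and> finite {W \<in> \<W>. \<exists>y\<in>V. g W y \<noteq> 0}}"
        "V' \<in> {V. openin X V \<and> finite {W \<in> \<W>. \<exists>y\<in>V. g W y \<noteq> 0}}"
        "x \<in> topspace X \<inter> id V \<inter> id V'" for V V' x
      using that eq by auto
    show "\<exists>V. V \<in> {V. openin X V \<and> finite {W \<in> \<W>. \<exists>y\<in>V. g W y \<noteq> 0}} \<and> x \<in> id V \<and>
        s x = (\<Sum>W | W \<in> \<W> \<and> (\<exists>y\<in>V. g W y \<noteq> 0). g W x)" if x: "x \<in> topspace X" for x
    proof -
      obtain V where V: "openin X V" "x \<in> V" "finite {W \<in> \<W>. \<exists>y\<in>V. g W y \<noteq> 0}"
        using nbhd[OF x] by blast
      then show ?thesis using eq[OF V(3,2)] by (intro exI[of _ V]) simp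
    qed
  qed auto
  have s_pos: "0 < s x" if x: "x \<in> topspace X" for x
  proof -
    obtain W where W: "W \<in> \<W>" "x \<in> F W" using F(3) x by blast
    then have "g W x \<le> s x"
      unfolding s_def using g(3) fin[OF x] g(2) x by (intro member_le_sum) auto
    then show ?thesis using g(3)[OF W] by simp
  qed
  have "partition_of_unity X \<W> (\<lambda>W x. g W x / s x)"
    unfolding partition_of_unity_def
  proof (intro conjI ballI)
    have zero: "g W x / s x \<noteq> 0 \<longleftrightarrow> g W x \<noteq> 0" if "x \<in> topspace X" for W x
      using s_pos[OF that] by simp
    show "continuous_map X euclideanreal (\<lambda>x. g W x / s x)" if "W \<in> \<W>" for W
      using g(1)[OF that] cs s_pos by (intro continuous_intros) (auto simp: less_imp_neq[symmetric])
    show "0 \<le> g W x / s x" if "W \<in> \<W>" "x \<in> topspace X" for W x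
      using g(2)[OF that] s_pos[OF that(2)] by simp
    show "X closure_of {x \<in> topspace X. g W x / s x \<noteq> 0} \<subseteq> W" if "W \<in> \<W>" for W
    proof -
      have "{x \<in> topspace X. g W x / s x \<noteq> 0} = {x \<in> topspace X. g W x \<noteq> 0}"
        using zero by blast
      then show ?thesis using g(4)[OF that] by simp
    qed
    show "\<exists>V. openin X V \<and> x \<in> V \<and> finite {W \<in> \<W>. \<exists>y\<in>V. g W y / s y \<noteq> 0}"
      if x: "x \<in> topspace X" for x
    proof -
      obtain V where V: "openin X V" "x \<in> V" "finite {W \<in> \<W>. \<exists>y\<in>V. g W y \<noteq> 0}"
        using nbhd[OF x] by blast
      have "{W \<in> \<W>. \<exists>y\<in>V. g W y / s y \<noteq> 0} \<subseteq> {W \<in> \<W>. \<exists>y\<in>V. g W y \<noteq> 0}" by auto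
      then show ?thesis using V finite_subset by blast
    qed
    show "(\<Sum>W | W \<in> \<W> \<and> g W x / s x \<noteq> 0. g W x / s x) = 1" if x: "x \<in> topspace X" for x
      using s_pos[OF x] unfolding zero[OF x] sum_divide_distrib[symmetric] s_def[symmetric] by simp
  qed
  then show thesis using that by blast
qed

subsection \<open>Realization of nerves and canonical maps\<close>

text \<open>Describes membership through the support of \<open>t\<close>, so that a point can be
  recognised in the face spanned by its support as well as in any larger finite simplex.\<close>

lemma closed_simplex_iff:
  assumes "finite \<sigma>"
  shows "t \<in> closed_simplex \<sigma> \<longleftrightarrow>
    (\<forall>v. 0 \<le> t v) \<and> {v. t v \<noteq> 0} \<subseteq> \<sigma> \<and> (\<Sum>v | t v \<noteq> 0. t v) = 1"
proof -
  have "sum t \<sigma> = (\<Sum>v | t v \<noteq> 0. t v)" if "{v. t v \<noteq> 0} \<subseteq> \<sigma>"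
    using assms that by (intro sum.mono_neutral_right) auto
  moreover have "(\<forall>v. v \<notin> \<sigma> \<longrightarrow> t v = 0) \<longleftrightarrow> {v. t v \<noteq> 0} \<subseteq> \<sigma>" by blast
  ultimately show ?thesis unfolding closed_simplex_def mem_Collect_eq by metis
qed

lemma closedin_geometric_realization:
  "closedin (geometric_realization K) C \<longleftrightarrow>
     C \<subseteq> (\<Union>\<sigma>\<in>K. closed_simplex \<sigma>) \<and>
     (\<forall>\<sigma>\<in>K. closedin (subtopology (powertop_real UNIV) (closed_simplex \<sigma>)) (C \<inter> closed_simplex \<sigma>))"
proof -
  have "((\<Union>\<sigma>\<in>K. closed_simplex \<sigma>) - C) \<inter> closed_simplex \<sigma> = closed_simplex \<sigma> - C \<inter> closed_simplex \<sigma>"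
    if "\<sigma> \<in> K" for \<sigma> using that by blast
  then show ?thesis
    unfolding closedin_def openin_geometric_realization topspace_geometric_realization by auto
qed

text \<open>Makes a set that is closed inside one simplex closed in the whole product, where finite
  unions over different simplices can be formed.\<close>

lemma closedin_closed_simplex: "closedin (powertop_real UNIV) (closed_simplex \<sigma>)"
proof -
  have proj: "continuous_map (powertop_real UNIV) euclideanreal (\<lambda>t. t v)" for v :: 'a
    by (rule continuous_map_product_projection) simp
  have sum: "continuous_map (powertop_real UNIV) euclideanreal (\<lambda>t. sum t \<sigma>)"
  proof (cases "finite \<sigma>")
    case True then show ?thesis by (rule continuous_map_sum) (rule proj)
  next
    \<comment> \<open>The sum over an infinite set is 0 by convention, so the map is
      constant.\<close>
    case False then show ?thesis by simp
  qed
  have eq: "closed_simplex \<sigma> = {t \<in> topspace (powertop_real UNIV). sum t \<sigma> \<in> {1}} \<inter>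
    ((\<Inter>v. {t \<in> topspace (powertop_real UNIV). t v \<in> {0..}}) \<inter>
    (\<Inter>v. {t \<in> topspace (powertop_real UNIV). t v \<in> (if v \<in> \<sigma> then UNIV else {0})}))"
    unfolding closed_simplex_def by (auto split: if_splits)
  show ?thesis unfolding eq
    by (intro closedin_Int closedin_INT closedin_continuous_map_preimage[OF proj]
        closedin_continuous_map_preimage[OF sum]) auto
qed

lemma openin_open_star: "openin (geometric_realization K) (open_star K v)"
  unfolding openin_geometric_realization
proof (intro conjI ballI)
  show "open_star K v \<subseteq> (\<Union>\<sigma>\<in>K. closed_simplex \<sigma>)"
    by (auto simp: open_star_def topspace_geometric_realization)
  fix \<sigma> assume "\<sigma> \<in> K"
  then have "open_star K v \<inter> closed_simplex \<sigma> =
      {t \<in> topspace (powertop_real UNIV). t v \<in> {0<..}} \<inter> closed_simplex \<sigma>"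
    by (auto simp: open_star_def topspace_geometric_realization)
  moreover have "openin (powertop_real UNIV) {t \<in> topspace (powertop_real UNIV). t v \<in> {0<..}}"
    by (rule openin_continuous_map_preimage[OF continuous_map_product_projection]) auto
  ultimately show "openin (subtopology (powertop_real UNIV) (closed_simplex \<sigma>)) (open_star K v \<inter> closed_simplex \<sigma>)"
    by (auto simp: openin_subtopology)
qed

text \<open>Coordinatewise continuity controls only the product topology. Where all but finitely
  many coordinates vanish, \<open>f\<close> stays in the finite subcomplex of simplices inside a
  finite vertex set \<open>F\<close>, and a weakly closed set meets this subcomplex in a finite
  union of sets closed in the product. Closure of \<open>K\<close> under faces puts the support of
  each \<open>f y\<close> among these simplices.\<close>

lemma continuous_map_geometric_realization:
  assumes coord: "\<And>v. continuous_map Z euclideanreal (\<lambda>z. f z v)"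
    and into: "\<And>z. z \<in> topspace Z \<Longrightarrow> f z \<in> topspace (geometric_realization K)"
    and fin: "\<And>z. z \<in> topspace Z \<Longrightarrow>
       \<exists>V. openin Z V \<and> z \<in> V \<and> finite {v. \<exists>y\<in>V. f y v \<noteq> 0}"
    and K: "\<And>\<sigma>. \<sigma> \<in> K \<Longrightarrow> finite \<sigma>" "\<And>\<sigma> \<tau>. \<sigma> \<in> K \<Longrightarrow> \<tau> \<subseteq> \<sigma> \<Longrightarrow> \<tau> \<noteq> {} \<Longrightarrow> \<tau> \<in> K"
  shows "continuous_map Z (geometric_realization K) f"
proof (rule pasting_lemma[where T = id and I = "{V. openin Z V \<and> finite {v. \<exists>y\<in>V. f y v \<noteq> 0}}"
      and f = "\<lambda>_. f"])
  show "\<exists>V. V \<in> {V. openin Z V \<and> finite {v. \<exists>y\<in>V. f y v \<noteq> 0}} \<and> z \<in> id V \<and> f z = f z"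
    if "z \<in> topspace Z" for z
    using fin[OF that] by auto
next
  fix V assume V: "V \<in> {V. openin Z V \<and> finite {v. \<exists>y\<in>V. f y v \<noteq> 0}}"
  define F where "F = {v. \<exists>y\<in>V. f y v \<noteq> 0}"
  have finF: "finite F" and subV: "V \<subseteq> topspace Z" using V openin_subset by (auto simp: F_def)
  have cont: "continuous_map (subtopology Z V) (powertop_real UNIV) f"
    unfolding continuous_map_componentwise_UNIV
    using coord by (auto intro: continuous_map_from_subtopology)
  have fV: "\<exists>\<tau>\<in>K. \<tau> \<subseteq> F \<and> f y \<in> closed_simplex \<tau>" if y: "y \<in> V" for y
  proof -
    obtain \<sigma> where \<sigma>: "\<sigma> \<in> K" "f y \<in> closed_simplex \<sigma>"
      using into y subV unfolding topspace_geometric_realization by blast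
    let ?\<tau> = "{v. f y v \<noteq> 0}"
    have f: "\<forall>v. 0 \<le> f y v" "?\<tau> \<subseteq> \<sigma>" "(\<Sum>v\<in>?\<tau>. f y v) = 1"
      using \<sigma> closed_simplex_iff[OF K(1)[OF \<sigma>(1)]] by auto
    then have "?\<tau> \<noteq> {}" by (intro notI) (simp only: sum.empty zero_neq_one)
    then have "?\<tau> \<in> K" using K(2)[OF \<sigma>(1) f(2)] by simp
    moreover have "f y \<in> closed_simplex ?\<tau>"
      using f K(1)[OF \<open>?\<tau> \<in> K\<close>] by (simp add: closed_simplex_iff)
    ultimately show ?thesis using y by (intro bexI[of _ ?\<tau>]) (auto simp: F_def)
  qed
  show "continuous_map (subtopology Z (id V)) (geometric_realization K) f"
    unfolding continuous_map_closedin
  proof (intro conjI allI impI)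
    show "f \<in> topspace (subtopology Z (id V)) \<rightarrow> topspace (geometric_realization K)"
      using into by auto
    fix C assume C: "closedin (geometric_realization K) C"
    define D where "D = (\<Union>\<tau>\<in>{\<tau>\<in>K. \<tau> \<subseteq> F}. C \<inter> closed_simplex \<tau>)"
    have "closedin (powertop_real UNIV) D" unfolding D_def
    proof (rule closedin_Union)
      have "finite {\<tau> \<in> K. \<tau> \<subseteq> F}" by (rule finite_subset[of _ "Pow F"]) (use finF in auto)
      then show "finite ((\<lambda>\<tau>. C \<inter> closed_simplex \<tau>) ` {\<tau> \<in> K. \<tau> \<subseteq> F})" by simp
      show "closedin (powertop_real UNIV) S" if "S \<in> (\<lambda>\<tau>. C \<inter> closed_simplex \<tau>) ` {\<tau> \<in> K. \<tau> \<subseteq> F}" for S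
        using that C closedin_trans_full[OF _ closedin_closed_simplex]
        unfolding closedin_geometric_realization by blast
    qed
    then have "closedin (subtopology Z V) {z \<in> topspace (subtopology Z V). f z \<in> D}"
      by (rule closedin_continuous_map_preimage[OF cont])
    moreover have "f z \<in> C \<longleftrightarrow> f z \<in> D" if "z \<in> V" for z
      using fV[OF that] unfolding D_def by blast
    then have "{z \<in> topspace (subtopology Z V). f z \<in> D} = {z \<in> topspace (subtopology Z V). f z \<in> C}"
      by auto
    ultimately show "closedin (subtopology Z (id V)) {z \<in> topspace (subtopology Z (id V)). f z \<in> C}"
      by simp
  qed
qed auto

text \<open>If infinitely many vertices occurred, choose for each a point of \<open>C\<close> with
  nonzero coordinate there. A simplex carries only finitely many of these points, so every set of
  them is closed in the weak topology. This would be an infinite closed discrete subset of a compact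
  set, against the Bolzano-Weierstrass property.\<close>

lemma compactin_geometric_realization_finite_support:
  assumes C: "compactin (geometric_realization K) C" and K: "\<And>\<sigma>. \<sigma> \<in> K \<Longrightarrow> finite \<sigma>"
  shows "finite {v. \<exists>t\<in>C. t v \<noteq> 0}"
proof (rule ccontr)
  let ?S = "{v. \<exists>t\<in>C. t v \<noteq> 0}"
  assume inf: "infinite ?S"
  obtain x where x: "\<And>v. v \<in> ?S \<Longrightarrow> x v \<in> C \<and> x v v \<noteq> 0"
    using bchoice[of ?S "\<lambda>v t. t \<in> C \<and> t v \<noteq> 0"] by blast
  have sub: "C \<subseteq> (\<Union>\<sigma>\<in>K. closed_simplex \<sigma>)"
    using compactin_subset_topspace[OF C] by (simp add: topspace_geometric_realization)
  have fin: "finite {v \<in> ?S. x v \<in> closed_simplex \<sigma>}" if "\<sigma> \<in> K" for \<sigma>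
    by (rule finite_subset[OF _ K[OF that]]) (use x in \<open>auto simp: closed_simplex_def\<close>)
  \<comment> \<open>\<open>x\<close> may fail to be injective, but one point has finite support and
    is therefore chosen for finitely many vertices only.\<close>
  have "finite {v \<in> ?S. x v = x w}" if w: "w \<in> ?S" for w
  proof -
    obtain \<sigma> where \<sigma>: "\<sigma> \<in> K" "x w \<in> closed_simplex \<sigma>" using x[OF w] sub by blast
    show ?thesis by (rule finite_subset[OF _ fin[OF \<sigma>(1)]]) (use \<sigma> in auto)
  qed
  then have infD: "infinite (x ` ?S)"
    using pigeonhole_infinite[OF inf, of x] by auto
  have closed: "closedin (geometric_realization K) D" if D: "D \<subseteq> x ` ?S" for D
    unfolding closedin_geometric_realization
  proof (intro conjI ballI)
    show "D \<subseteq> (\<Union>\<sigma>\<in>K. closed_simplex \<sigma>)" using D x sub by blast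
    fix \<sigma> assume \<sigma>: "\<sigma> \<in> K"
    have "D \<inter> closed_simplex \<sigma> \<subseteq> x ` {v \<in> ?S. x v \<in> closed_simplex \<sigma>}" using D by blast
    then have "finite (D \<inter> closed_simplex \<sigma>)" using fin[OF \<sigma>] by (meson finite_imageI finite_subset)
    then show "closedin (subtopology (powertop_real UNIV) (closed_simplex \<sigma>)) (D \<inter> closed_simplex \<sigma>)"
      by (intro closedin_Hausdorff_finite Hausdorff_space_subtopology)
        (auto simp: Hausdorff_space_product_topology)
  qed
  obtain z where z: "z \<in> geometric_realization K derived_set_of (x ` ?S)"
    using compactin_imp_Bolzano_Weierstrass[OF C] infD x by blast
  define T where "T = topspace (geometric_realization K) - (x ` ?S - {z})"
  have "closedin (geometric_realization K) (x ` ?S - {z})" by (rule closed) blast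
  then have "openin (geometric_realization K) T"
    unfolding T_def by (rule openin_diff[OF openin_topspace])
  moreover have "z \<in> T" using z unfolding T_def in_derived_set_of by simp
  ultimately obtain y where "y \<noteq> z" "y \<in> x ` ?S" "y \<in> T"
    using z unfolding in_derived_set_of by blast
  then show False unfolding T_def by simp
qed

lemma continuous_map_realization_coordinate:
  "continuous_map (geometric_realization K) euclideanreal (\<lambda>t. t w)"
  unfolding continuous_map_closedin
proof (intro conjI allI impI)
  fix C :: "real set" assume C: "closedin euclidean C"
  have "{t \<in> topspace (geometric_realization K). t w \<in> C} \<inter> closed_simplex \<sigma> =
      {t \<in> topspace (powertop_real UNIV). t w \<in> C} \<inter> closed_simplex \<sigma>" if "\<sigma> \<in> K" for \<sigma>
    using that by (auto simp: topspace_geometric_realization)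
  moreover have "closedin (powertop_real UNIV) {t \<in> topspace (powertop_real UNIV). t w \<in> C}"
    by (rule closedin_continuous_map_preimage[OF continuous_map_product_projection _]) (use C in auto)
  ultimately show "closedin (geometric_realization K) {t \<in> topspace (geometric_realization K). t w \<in> C}"
    unfolding closedin_geometric_realization
    by (auto simp: closedin_subtopology topspace_geometric_realization)
qed auto

section \<open>Nerves, open stars and canonical maps\<close>

lemma finite_nerve: "\<sigma> \<in> nerve \<U> \<Longrightarrow> finite \<sigma>"
  and nerve_mono: "\<sigma> \<in> nerve \<U> \<Longrightarrow> \<tau> \<subseteq> \<sigma> \<Longrightarrow> \<tau> \<noteq> {} \<Longrightarrow> \<tau> \<in> nerve \<U>"
proof -
  show "\<sigma> \<in> nerve \<U> \<Longrightarrow> finite \<sigma>" by (simp add: nerve_def)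
  assume "\<sigma> \<in> nerve \<U>" "\<tau> \<subseteq> \<sigma>" "\<tau> \<noteq> {}"
  moreover from this have "\<Inter>\<tau> \<noteq> {}" unfolding nerve_def by blast
  ultimately show "\<tau> \<in> nerve \<U>" by (auto simp: nerve_def intro: finite_subset)
qed

lemma closed_simplex_nonzero:
  assumes "t \<in> closed_simplex \<sigma>" "finite \<sigma>"
  shows "\<exists>v. t v \<noteq> 0"
proof -
  have "(\<Sum>v | t v \<noteq> 0. t v) = 1" using assms by (auto simp: closed_simplex_iff)
  then show ?thesis by (metis (mono_tags, lifting) Collect_empty_eq sum.empty zero_neq_one)
qed

lemma ex_open_star:
  assumes "t \<in> topspace (geometric_realization K)" "\<And>\<sigma>. \<sigma> \<in> K \<Longrightarrow> finite \<sigma>"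
  shows "\<exists>\<sigma>\<in>K. \<exists>v\<in>\<sigma>. t \<in> open_star K v"
proof -
  obtain \<sigma> where \<sigma>: "\<sigma> \<in> K" "t \<in> closed_simplex \<sigma>"
    using assms(1) by (auto simp: topspace_geometric_realization)
  then obtain v where v: "t v \<noteq> 0"
    using closed_simplex_nonzero assms(2) by blast
  have "v \<in> \<sigma>" "0 < t v"
    using \<sigma>(2) v by (auto simp: closed_simplex_def less_le)
  then show ?thesis using \<sigma>(1) assms(1) by (auto simp: open_star_def)
qed

text \<open>The stars through \<open>t\<close> belong to the vertices in the support of
  \<open>t\<close>, which are among the vertices of any simplex \<open>\<sigma>\<close> carrying
  \<open>t\<close>; a common point of the members of \<open>\<sigma>\<close> is common to them. This
  supplies the point at which the cocycle identity is checked.\<close>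

lemma open_star_nerve_Inter:
  assumes t: "t \<in> topspace (geometric_realization (nerve \<U>))" 
  shows "\<Inter>{V. t \<in> open_star (nerve \<U>) V} \<noteq> {}" "{V. t \<in> open_star (nerve \<U>) V} \<subseteq> \<U>"
proof -
  obtain \<sigma> where \<sigma>: "\<sigma> \<in> nerve \<U>" "t \<in> closed_simplex \<sigma>"
    using t by (auto simp: topspace_geometric_realization)
  have "{V. t \<in> open_star (nerve \<U>) V} \<subseteq> \<sigma>"
    using \<sigma>(2) by (auto simp: open_star_def closed_simplex_def less_le)
  moreover have "\<Inter>\<sigma> \<noteq> {}" "\<sigma> \<subseteq> \<U>" using \<sigma>(1) by (auto simp: nerve_def)
  ultimately show "\<Inter>{V. t \<in> open_star (nerve \<U>) V} \<noteq> {}" "{V. t \<in> open_star (nerve \<U>) V} \<subseteq> \<U>"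
    by blast+
qed

lemma canonical_map_exists:
  assumes c: "c \<in> normal_pointed_covers X x0" and x0: "x0 \<in> topspace X"
  shows "\<exists>p. canonical_map X x0 c p"
proof -
  obtain \<U> U0 where c_eq: "c = (\<U>, U0)" by fastforce
  obtain \<phi> where U: "open_cover X \<U>" "U0 \<in> \<U>" "x0 \<in> U0"
    and pou: "partition_of_unity X \<U> \<phi>" and \<phi>0: "\<phi> U0 x0 = 1"
    using c unfolding c_eq normal_pointed_covers_def by blast
  have cont: "continuous_map X euclideanreal (\<phi> U)" 
    and nonneg: "x \<in> topspace X \<Longrightarrow> 0 \<le> \<phi> U x"
    and supp: "X closure_of {x \<in> topspace X. \<phi> U x \<noteq> 0} \<subseteq> U" if "U \<in> \<U>" for U x
    using pou that unfolding partition_of_unity_def by auto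
  have nbhd: "\<exists>V. openin X V \<and> x \<in> V \<and> finite {U \<in> \<U>. \<exists>y\<in>V. \<phi> U y \<noteq> 0}"
    and sum1: "(\<Sum>U | U \<in> \<U> \<and> \<phi> U x \<noteq> 0. \<phi> U x) = 1" if "x \<in> topspace X" for x
    using pou that unfolding partition_of_unity_def by auto
  have supp': "x \<in> U" if "U \<in> \<U>" "x \<in> topspace X" "\<phi> U x \<noteq> 0" for U x
    using supp[OF that(1)] closure_of_subset[of "{x \<in> topspace X. \<phi> U x \<noteq> 0}" X] that(2,3) by blast
  have fin: "finite {U \<in> \<U>. \<phi> U x \<noteq> 0}" if "x \<in> topspace X" for x
  proof -
    obtain V where V: "x \<in> V" "finite {U \<in> \<U>. \<exists>y\<in>V. \<phi> U y \<noteq> 0}" using nbhd[OF \<open>x \<in> topspace X\<close>] by blast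
    show ?thesis by (rule finite_subset[OF _ V(2)]) (use V(1) in blast)
  qed
  \<comment> \<open>The partition functions are the barycentric coordinates. Points of the
    realization are functions on all sets, whereas \<open>\<phi>\<close> is constrained on
    \<open>\<U>\<close> only; hence the value 0 elsewhere.\<close>
  define p where "p x U = (if U \<in> \<U> then \<phi> U x else 0)" for x U
  have p0: "{U. p x U \<noteq> 0} = {U \<in> \<U>. \<phi> U x \<noteq> 0}" for x
    by (auto simp: p_def)
  have in_nerve: "{U \<in> \<U>. \<phi> U x \<noteq> 0} \<in> nerve \<U>" if x: "x \<in> topspace X" for x
  proof -
    have "{U \<in> \<U>. \<phi> U x \<noteq> 0} \<noteq> {}" using sum1[OF x] by (metis sum.empty zero_neq_one)
    moreover have "x \<in> \<Inter>{U \<in> \<U>. \<phi> U x \<noteq> 0}" using supp' x by blast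
    ultimately show ?thesis using fin[OF x] unfolding nerve_def by blast
  qed
  have into: "p x \<in> topspace (geometric_realization (nerve \<U>))" if x: "x \<in> topspace X" for x
  proof -
    have "(\<Sum>U\<in>{U. p x U \<noteq> 0}. p x U) = 1"
      unfolding p0 sum1[OF x, symmetric] by (rule sum.cong) (auto simp: p_def)
    then have "p x \<in> closed_simplex {U \<in> \<U>. \<phi> U x \<noteq> 0}"
      using nonneg x by (auto simp: closed_simplex_iff[OF fin[OF x]] p_def)
    then show ?thesis using in_nerve[OF x] unfolding topspace_geometric_realization by blast
  qed
  have "canonical_map X x0 c p"
    unfolding canonical_map_def nerve_space_def c_eq fst_conv snd_conv
  proof (intro conjI ballI)
    show "continuous_map X (geometric_realization (nerve \<U>)) p"
    proof (rule continuous_map_geometric_realization)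
      show "continuous_map X euclideanreal (\<lambda>x. p x U)" for U
        by (cases "U \<in> \<U>") (simp_all add: p_def cont)
      show "\<exists>V. openin X V \<and> x \<in> V \<and> finite {U. \<exists>y\<in>V. p y U \<noteq> 0}" if x: "x \<in> topspace X" for x
      proof -
        have "{U. \<exists>y\<in>V. p y U \<noteq> 0} = {U \<in> \<U>. \<exists>y\<in>V. \<phi> U y \<noteq> 0}" for V
          by (auto simp: p_def)
        then show ?thesis using nbhd[OF x] by simp
      qed
    qed (use into finite_nerve in \<open>auto intro: nerve_mono\<close>)
    show "p x0 = vertex_point U0"
    proof
      \<comment> \<open>\<open>\<phi> U0 x0 = 1\<close> exhausts the total weight, so nonnegativity
        forces every other weight at \<open>x0\<close> to vanish.\<close>
      have "{U \<in> \<U>. \<phi> U x0 \<noteq> 0} = {U0}"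
      proof -
        have "(\<Sum>U\<in>{U \<in> \<U>. \<phi> U x0 \<noteq> 0} - {U0}. \<phi> U x0) = 0"
          using sum1[OF x0] sum.remove[OF fin[OF x0], of U0 "\<lambda>U. \<phi> U x0"] U(2) \<phi>0 by simp
        then have "\<forall>U\<in>{U \<in> \<U>. \<phi> U x0 \<noteq> 0} - {U0}. \<phi> U x0 = 0"
          by (subst (asm) sum_nonneg_eq_0_iff) (use fin[OF x0] nonneg x0 in auto)
        then show ?thesis using U(2) \<phi>0 by auto
      qed
      then show "p x0 U = vertex_point U0 U" for U
        using \<phi>0 U(2) by (auto simp: p_def vertex_point_def)
    qed
    show "{x \<in> topspace X. p x \<in> open_star (nerve \<U>) U} \<subseteq> U" if "U \<in> \<U>" for U
      using supp' that by (auto simp: open_star_def p_def)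
  qed
  then show ?thesis by blast
qed

text \<open>Pushing \<open>g\<close> linearly towards \<open>v\<close> stays in the realization,
  because every simplex that carries \<open>g t\<close> contains \<open>v\<close>. This contraction
  \<open>F\<close> moves the base point along \<open>F (s, 0)\<close>, so it is only a free
  homotopy; going around the boundary of the square turns it into one with fixed endpoints.\<close>

lemma loop_in_open_star_null:
  assumes g: "pathin (geometric_realization K) g" "g 1 = g 0"
    and star: "\<And>t. t \<in> {0..1} \<Longrightarrow> g t \<in> open_star K v"
    and K: "\<And>\<sigma>. \<sigma> \<in> K \<Longrightarrow> finite \<sigma>" "\<And>\<sigma> \<tau>. \<sigma> \<in> K \<Longrightarrow> \<tau> \<subseteq> \<sigma> \<Longrightarrow> \<tau> \<noteq> {} \<Longrightarrow> \<tau> \<in> K"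
  shows "path_homotopic (geometric_realization K) g (\<lambda>_. g 0)"
proof -
  let ?R = "geometric_realization K" and ?I = "{0..1::real}"
  define F where "F z w = (1 - fst z) * g (snd z) w + fst z * vertex_point v w" for z w
  \<comment> \<open>Compactness of the loop bounds its support. The continuity criterion for the
    weak topology can then be applied to \<open>F\<close> with the whole square as neighbourhood of
    every point.\<close>
  have supp: "finite {w. \<exists>t\<in>?I. g t w \<noteq> 0}"
  proof -
    have "compactin (top_of_set ?I) ?I" by (simp add: compactin_subtopology)
    then have "compactin ?R (g ` ?I)"
      using g(1) unfolding pathin_def by (rule image_compactin)
    from compactin_geometric_realization_finite_support[OF this K(1)] show ?thesis by simp
  qed
  have gcoord: "continuous_on ?I (\<lambda>t. g t w)" for w
  proof -
    have "continuous_map (top_of_set ?I) euclideanreal ((\<lambda>t. t w) \<circ> g)"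
      using g(1)[unfolded pathin_def] continuous_map_realization_coordinate by (rule continuous_map_compose)
    then show ?thesis by (simp add: o_def)
  qed
  have F: "continuous_map (top_of_set (?I \<times> ?I)) ?R F"
  proof (rule continuous_map_geometric_realization[OF _ _ _ K])
    have "continuous_on (?I \<times> ?I) (\<lambda>z. g (snd z) w)" for w
      by (rule continuous_on_compose2[OF gcoord]) (auto intro!: continuous_intros)
    then show "continuous_map (top_of_set (?I \<times> ?I)) euclideanreal (\<lambda>z. F z w)" for w
      unfolding F_def by (auto intro!: continuous_intros)
    show "F z \<in> topspace ?R" if "z \<in> topspace (top_of_set (?I \<times> ?I))" for z
    proof -
      obtain s t where z: "z = (s, t)" "s \<in> ?I" "t \<in> ?I" using \<open>z \<in> _\<close> by auto
      obtain \<sigma> where \<sigma>: "\<sigma> \<in> K" "g t \<in> closed_simplex \<sigma>" and v: "0 < g t v"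
        using star[OF z(3)] by (auto simp: open_star_def topspace_geometric_realization)
      have v\<sigma>: "v \<in> \<sigma>" using \<sigma>(2) v by (auto simp: closed_simplex_def)
      have "F z \<in> closed_simplex \<sigma>"
        unfolding closed_simplex_def mem_Collect_eq
      proof (intro conjI allI impI)
        show "0 \<le> F z w" for w using \<sigma>(2) z by (auto simp: F_def closed_simplex_def vertex_point_def)
        show "F z w = 0" if "w \<notin> \<sigma>" for w
          using \<sigma>(2) v\<sigma> that z(1) by (auto simp: F_def closed_simplex_def vertex_point_def)
        have "sum (vertex_point v) \<sigma> = 1"
          using v\<sigma> K(1)[OF \<sigma>(1)] by (simp add: vertex_point_def)
        moreover have "sum (g t) \<sigma> = 1" using \<sigma>(2) by (simp add: closed_simplex_def)
        ultimately show "sum (F z) \<sigma> = 1"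
          unfolding F_def by (simp add: sum.distrib sum_distrib_left[symmetric] z)
      qed
      then show ?thesis using \<sigma>(1) by (auto simp: topspace_geometric_realization)
    qed
    have "{w. \<exists>z\<in>?I \<times> ?I. F z w \<noteq> 0} \<subseteq> insert v {w. \<exists>t\<in>?I. g t w \<noteq> 0}"
      by (auto simp: F_def vertex_point_def)
    then have "finite {w. \<exists>z\<in>?I \<times> ?I. F z w \<noteq> 0}" using supp by (meson finite_insert finite_subset)
    then show "\<exists>V. openin (top_of_set (?I \<times> ?I)) V \<and> z \<in> V \<and> finite {w. \<exists>y\<in>V. F y w \<noteq> 0}"
      if "z \<in> topspace (top_of_set (?I \<times> ?I))" for z
      using that by (intro exI[of _ "?I \<times> ?I"]) auto
  qed
  \<comment> \<open>\<open>\<zeta>\<close> runs around the other three sides of the square; \<open>F\<close> agrees on two of them and collapses the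
    third to the vertex, so \<open>F \<circ> \<zeta>\<close> retraces itself.\<close>
  define \<theta> where "\<theta> t = min 1 (min (3 * t) (3 - 3 * t))" for t :: real
  define \<eta> where "\<eta> t = (0::real, t)" for t :: real
  define \<zeta> where "\<zeta> t = (\<theta> t, max 0 (min 1 (3 * t - 1)))" for t
  have "homotopic_paths (?I \<times> ?I) \<eta> \<zeta>"
  proof (rule homotopic_paths_linear)
    show "path \<eta>" "path \<zeta>"
      unfolding path_def \<eta>_def \<zeta>_def \<theta>_def by (auto intro!: continuous_intros)
    show "pathstart \<zeta> = pathstart \<eta>" "pathfinish \<zeta> = pathfinish \<eta>"
      by (simp_all add: pathstart_def pathfinish_def \<eta>_def \<zeta>_def \<theta>_def)
    show "closed_segment (\<eta> t) (\<zeta> t) \<subseteq> ?I \<times> ?I" if "t \<in> ?I" for t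
    proof (rule closed_segment_subset)
      show "convex (?I \<times> ?I)" by (intro convex_Times) auto
    qed (use that in \<open>auto simp: \<eta>_def \<zeta>_def \<theta>_def\<close>)
  qed
  then have "path_homotopic (top_of_set (?I \<times> ?I)) \<eta> \<zeta>"
    by (simp add: homotopic_paths_def path_homotopic_def pathstart_def pathfinish_def)
  from path_homotopic_compose[OF this F]
  have 1: "path_homotopic ?R (F \<circ> \<eta>) (F \<circ> \<zeta>)" .
  have \<eta>: "F \<circ> \<eta> = g" by (auto simp: F_def \<eta>_def fun_eq_iff)
  have 2: "path_homotopic ?R (F \<circ> \<zeta>) (\<lambda>_. g 0)"
  proof (rule path_homotopic_reparam[where P = "\<lambda>s. F (s, 0)" and \<phi> = \<theta> and \<psi> = "\<lambda>_. 0"])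
    have "continuous_map (top_of_set ?I) ?R (F \<circ> (\<lambda>s. (s, 0)))"
      by (rule continuous_map_compose[OF _ F]) (auto intro!: continuous_intros)
    then show "pathin ?R (\<lambda>s. F (s, 0))" by (simp add: pathin_def o_def)
    show "(F \<circ> \<zeta>) t = F (\<theta> t, 0)" if "t \<in> ?I" for t
    proof -
      consider "t \<le> 1/3" | "1/3 \<le> t" "t \<le> 2/3" | "2/3 \<le> t" by linarith
      then show ?thesis
      proof cases
        case 1 then have "max 0 (min 1 (3 * t - 1)) = 0" by auto
        then show ?thesis by (simp add: \<zeta>_def)
      next
        case 2 then have "\<theta> t = 1" by (auto simp: \<theta>_def)
        then show ?thesis by (auto simp: \<zeta>_def F_def fun_eq_iff)
      next
        case 3 then have "max 0 (min 1 (3 * t - 1)) = 1" by auto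
        then show ?thesis using g(2) by (auto simp: \<zeta>_def F_def fun_eq_iff)
      qed
    qed
    show "g 0 = F (0, 0)" by (auto simp: F_def fun_eq_iff)
  qed (auto intro!: continuous_intros simp: \<theta>_def)
  show ?thesis using path_homotopic_trans[OF 1 2] unfolding \<eta> .
qed

section \<open>Normal pointed covers refining a given open cover\<close>

lemma locally_finite_in_insert:
  assumes "locally_finite_in X \<A>" "U \<subseteq> topspace X"
  shows "locally_finite_in X (insert U \<A>)"
  unfolding locally_finite_in_def
proof (intro conjI ballI)
  show "\<Union>(insert U \<A>) \<subseteq> topspace X" using assms by (auto simp: locally_finite_in_def)
  fix x assume "x \<in> topspace X"
  then obtain V where V: "openin X V" "x \<in> V" "finite {A \<in> \<A>. A \<inter> V \<noteq> {}}"
    using assms(1) unfolding locally_finite_in_def by blast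
  moreover have "{A \<in> insert U \<A>. A \<inter> V \<noteq> {}} \<subseteq> insert U {A \<in> \<A>. A \<inter> V \<noteq> {}}" by blast
  ultimately show "\<exists>V. openin X V \<and> x \<in> V \<and> finite {A \<in> insert U \<A>. A \<inter> V \<noteq> {}}"
    using finite_subset[OF _ finite.insertI[OF V(3)]] by blast
qed

lemma normal_pointed_cover_refining:
  assumes X: "paracompact_space X" "Hausdorff_space X" and \<W>: "open_cover X \<W>" and x0: "x0 \<in> topspace X"
  obtains \<V> V0 where "(\<V>, V0) \<in> normal_pointed_covers X x0" "cover_refines \<V> \<W>"
proof -
  obtain \<O> where \<O>: "open_cover X \<O>" "cover_refines \<O> \<W>" "locally_finite_in X \<O>"
    using paracompact_spaceD[OF X(1) \<W>] by metis
  obtain V0 where V0: "V0 \<in> \<O>" "x0 \<in> V0" using open_coverD(3)[OF \<O>(1)] x0 by blast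
  \<comment> \<open>Puncturing all members but one leaves a single member at the base point, which forces
    its weight there to be 1.\<close>
  define \<V> where "\<V> = insert V0 ((\<lambda>U. U - {x0}) ` \<O>)"
  have "closedin X {x0}" using closedin_Hausdorff_sing_eq[OF X(2)] x0 by simp
  then have "openin X V" if "V \<in> \<V>" for V
    using that V0(1) open_coverD(1)[OF \<O>(1)] by (auto simp: \<V>_def)
  moreover have "\<Union>\<V> = topspace X"
    using V0 open_coverD(3)[OF \<O>(1)] by (auto simp: \<V>_def)
  ultimately have cover: "open_cover X \<V>" by (simp add: open_cover_def)
  have "locally_finite_in X \<V>"
    unfolding \<V>_def using V0(1) open_coverD(2)[OF \<O>(1)]
    by (intro locally_finite_in_insert locally_finite_in_refinement[OF \<O>(3)]) auto
  then obtain \<phi> where \<phi>: "partition_of_unity X \<V> \<phi>"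
    using partition_of_unity_exists[OF X cover] by metis
  have "V = V0" if V: "V \<in> \<V>" "\<phi> V x0 \<noteq> 0" for V
  proof -
    have "X closure_of {x \<in> topspace X. \<phi> V x \<noteq> 0} \<subseteq> V"
      using \<phi> V(1) unfolding partition_of_unity_def by blast
    then have "x0 \<in> V"
      using closure_of_subset[of "{x \<in> topspace X. \<phi> V x \<noteq> 0}" X] V(2) x0 by blast
    then show ?thesis using V(1) by (auto simp: \<V>_def)
  qed
  then have sub: "{V \<in> \<V>. \<phi> V x0 \<noteq> 0} \<subseteq> {V0}" by blast
  have sum: "(\<Sum>V\<in>{V \<in> \<V>. \<phi> V x0 \<noteq> 0}. \<phi> V x0) = 1"
    using \<phi> x0 unfolding partition_of_unity_def by blast
  then have "{V \<in> \<V>. \<phi> V x0 \<noteq> 0} \<noteq> {}" by (metis sum.empty zero_neq_one)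
  with sub have "{V \<in> \<V>. \<phi> V x0 \<noteq> 0} = {V0}" by blast
  with sum have "\<phi> V0 x0 = 1" by simp
  then have "(\<V>, V0) \<in> normal_pointed_covers X x0"
    using cover \<phi> V0(2) by (auto simp: normal_pointed_covers_def \<V>_def)
  moreover have "cover_refines \<V> \<W>"
    unfolding cover_refines_def
  proof
    fix V assume "V \<in> \<V>"
    then obtain U where "U \<in> \<O>" "V \<subseteq> U" using V0(1) unfolding \<V>_def by blast
    then show "\<exists>W\<in>\<W>. V \<subseteq> W" using \<O>(2) unfolding cover_refines_def by (meson subset_trans)
  qed
  ultimately show thesis using that by blast
qed

subsection \<open>Parallel sections of a cocycle over the square\<close>

lemma (in group) inv_cancel_left:
  assumes "x \<in> carrier G" "y \<in> carrier G"
  shows "inv x \<otimes> (x \<otimes> y) = y" "x \<otimes> (inv x \<otimes> y) = y"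
  using assms by (simp_all add: m_assoc[symmetric])

text \<open>
  \<open>L z\<close> is the set of charts at \<open>z\<close>, and \<open>c z v\<close> the value at \<open>z\<close>, read in the chart \<open>v\<close>, of a flat section
  of the principal bundle with transition functions \<open>g\<close>.
\<close>

definition parallel_section ::
  "('g, 'b) monoid_scheme \<Rightarrow> ('i \<Rightarrow> 'i \<Rightarrow> 'g) \<Rightarrow> ('z::topological_space \<Rightarrow> 'i set) \<Rightarrow> 'z set \<Rightarrow> ('z \<Rightarrow> 'i \<Rightarrow> 'g) \<Rightarrow> bool"
  where "parallel_section G g L D c \<longleftrightarrow>
    (\<forall>z\<in>D. \<forall>v\<in>L z. c z v \<in> carrier G \<and> (\<forall>w\<in>L z. c z w = c z v \<otimes>\<^bsub>G\<^esub> g v w) \<and>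
       (\<forall>\<^sub>F z' in at z within D. v \<in> L z' \<and> c z' v = c z v))"

lemma parallel_sectionD:
  assumes "parallel_section G g L D c" "z \<in> D" "v \<in> L z"
  shows "c z v \<in> carrier G" "w \<in> L z \<Longrightarrow> c z w = c z v \<otimes>\<^bsub>G\<^esub> g v w"
    "\<forall>\<^sub>F z' in at z within D. v \<in> L z' \<and> c z' v = c z v"
  using assms unfolding parallel_section_def by blast+

lemma parallel_section_subset:
  assumes "parallel_section G g L D c" "D' \<subseteq> D"
  shows "parallel_section G g L D' c"
  unfolding parallel_section_def
proof (intro ballI conjI)
  fix z v assume z: "z \<in> D'" and v: "v \<in> L z"
  have zD: "z \<in> D" using z assms(2) by blast
  show "c z v \<in> carrier G" using parallel_sectionD(1)[OF assms(1) zD v] .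
  show "c z w = c z v \<otimes>\<^bsub>G\<^esub> g v w" if "w \<in> L z" for w
    using parallel_sectionD(2)[OF assms(1) zD v that] .
  show "\<forall>\<^sub>F z' in at z within D'. v \<in> L z' \<and> c z' v = c z v"
    using filter_leD[OF at_le[OF assms(2)] parallel_sectionD(3)[OF assms(1) zD v]] .
qed

lemma parallel_section_const:
  assumes c: "parallel_section G g L D c" and E: "connected E" "E \<subseteq> D" "x \<in> E" "y \<in> E"
    and v: "\<And>z. z \<in> E \<Longrightarrow> v \<in> L z"
  shows "c x v = c y v"
proof (rule connected_local_const[OF E(1,3,4)], intro ballI)
  fix a assume a: "a \<in> E"
  have "\<forall>\<^sub>F b in at a within E. v \<in> L b \<and> c b v = c a v"
    using parallel_sectionD(3)[OF parallel_section_subset[OF c E(2)] a v[OF a]] .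
  then show "\<forall>\<^sub>F b in at a within E. c a v = c b v" by (rule eventually_mono) simp
qed

text \<open>Transition functions act on the right, so the quotient
  \<open>c1 z v \<otimes> inv (c2 z v)\<close> of two sections is independent of the chart. It is
  locally constant, hence a constant \<open>K\<close> on the connected overlap. Left multiplication
  by \<open>K\<close> preserves flatness and makes \<open>c2\<close> agree with \<open>c1\<close>
  there.\<close>

lemma (in group) parallel_section_glue:
  assumes c1: "parallel_section G g L D1 c1" and c2: "parallel_section G g L D2 c2"
    and D: "closed D1" "closed D2" "connected (D1 \<inter> D2)" "D1 \<inter> D2 \<noteq> {}"
    and L: "\<And>z. z \<in> D1 \<inter> D2 \<Longrightarrow> L z \<noteq> {}"
    and g: "\<And>z v w. z \<in> D1 \<union> D2 \<Longrightarrow> v \<in> L z \<Longrightarrow> w \<in> L z \<Longrightarrow> g v w \<in> carrier G"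
  shows "\<exists>c. parallel_section G g L (D1 \<union> D2) c"
proof -
  define k where "k z = (let v = SOME v. v \<in> L z in c1 z v \<otimes> inv (c2 z v))" for z
  have k: "c1 z v \<otimes> inv (c2 z v) = k z" if z: "z \<in> D1 \<inter> D2" and v: "v \<in> L z" for z v
  proof -
    define w where "w = (SOME v. v \<in> L z)"
    have w: "w \<in> L z" unfolding w_def using v by (rule someI)
    have car: "c1 z v \<in> carrier G" "c2 z v \<in> carrier G" "g v w \<in> carrier G"
      using parallel_sectionD(1)[OF c1 _ v] parallel_sectionD(1)[OF c2 _ v] g[OF _ v w] z by auto
    have "c1 z w = c1 z v \<otimes> g v w" "c2 z w = c2 z v \<otimes> g v w"
      using parallel_sectionD(2)[OF c1 _ v w] parallel_sectionD(2)[OF c2 _ v w] z by blast+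
    then have "k z = (c1 z v \<otimes> g v w) \<otimes> inv (c2 z v \<otimes> g v w)"
      unfolding k_def w_def[symmetric] by simp
    also have "\<dots> = c1 z v \<otimes> inv (c2 z v)"
      using car by (simp add: inv_mult_group m_assoc inv_cancel_left)
    finally show ?thesis by simp
  qed
  obtain z0 where z0: "z0 \<in> D1 \<inter> D2" using D(4) by blast
  define K where "K = k z0"
  have kK: "k z = K" if z: "z \<in> D1 \<inter> D2" for z
    unfolding K_def
  proof (rule connected_local_const[OF D(3) z z0], intro ballI)
    fix a assume a: "a \<in> D1 \<inter> D2"
    then obtain v where v: "v \<in> L a" using L by blast
    have "\<forall>\<^sub>F b in at a within D1 \<inter> D2. v \<in> L b \<and> c1 b v = c1 a v"
      "\<forall>\<^sub>F b in at a within D1 \<inter> D2. v \<in> L b \<and> c2 b v = c2 a v"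
      using parallel_sectionD(3)[OF parallel_section_subset[OF c1 Int_lower1] a v]
        parallel_sectionD(3)[OF parallel_section_subset[OF c2 Int_lower2] a v] .
    moreover have "\<forall>\<^sub>F b in at a within D1 \<inter> D2. b \<in> D1 \<inter> D2" by (simp add: eventually_at_filter)
    ultimately show "\<forall>\<^sub>F b in at a within D1 \<inter> D2. k a = k b"
    proof eventually_elim
      case (elim b) then show ?case using k[OF a v] k[of b v] by simp
    qed
  qed
  have K: "K \<in> carrier G"
  proof -
    obtain v where v: "v \<in> L z0" using L[OF z0] by blast
    then show ?thesis using parallel_sectionD(1)[OF c1 _ v] parallel_sectionD(1)[OF c2 _ v] z0
      unfolding K_def k[OF z0 v, symmetric] by auto
  qed
  define c where "c z v = (if z \<in> D1 then c1 z v else K \<otimes> c2 z v)" for z v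
  have c_D2: "c z v = K \<otimes> c2 z v" if z: "z \<in> D2" and v: "v \<in> L z" for z v
  proof (cases "z \<in> D1")
    case True
    then have "c1 z v \<otimes> inv (c2 z v) = K" using k kK z v by auto
    then show ?thesis
      using True parallel_sectionD(1)[OF c1 _ v] parallel_sectionD(1)[OF c2 z v]
      by (auto simp: c_def m_assoc)
  qed (simp add: c_def)
  have "parallel_section G g L (D1 \<union> D2) c"
    unfolding parallel_section_def
  proof (intro ballI conjI)
    fix z v assume z: "z \<in> D1 \<union> D2" and v: "v \<in> L z"
    show "c z v \<in> carrier G"
      using z K parallel_sectionD(1)[OF c1 _ v] parallel_sectionD(1)[OF c2 _ v] by (auto simp: c_def)
    show "c z w = c z v \<otimes> g v w" if w: "w \<in> L z" for w
    proof (cases "z \<in> D1")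
      case True then show ?thesis using parallel_sectionD(2)[OF c1 True v w] by (simp add: c_def)
    next
      case False
      then have z2: "z \<in> D2" using z by blast
      then show ?thesis
        using False parallel_sectionD(2)[OF c2 z2 v w] parallel_sectionD(1)[OF c2 z2 v] K g[OF z v w]
        by (simp add: c_def m_assoc)
    qed
    \<comment> \<open>Local constancy is checked on each piece separately; if \<open>z\<close> lies
      outside a piece, that piece is closed and the filter within it is trivial.\<close>
    have 1: "\<forall>\<^sub>F z' in at z within D1. v \<in> L z' \<and> c z' v = c z v"
    proof (cases "z \<in> D1")
      case True
      have "\<forall>\<^sub>F z' in at z within D1. z' \<in> D1" by (simp add: eventually_at_filter)
      with parallel_sectionD(3)[OF c1 True v] show ?thesis
        by eventually_elim (use True in \<open>simp add: c_def\<close>)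
    next
      case False
      then have "at z within D1 = bot" using D(1) by (intro not_in_closure_trivial_limitI) simp
      then show ?thesis by simp
    qed
    have 2: "\<forall>\<^sub>F z' in at z within D2. v \<in> L z' \<and> c z' v = c z v"
    proof (cases "z \<in> D2")
      case True
      have "\<forall>\<^sub>F z' in at z within D2. z' \<in> D2" by (simp add: eventually_at_filter)
      with parallel_sectionD(3)[OF c2 True v] show ?thesis
        by eventually_elim (use True v in \<open>simp add: c_D2\<close>)
    next
      case False
      then have "at z within D2 = bot" using D(2) by (intro not_in_closure_trivial_limitI) simp
      then show ?thesis by simp
    qed
    show "\<forall>\<^sub>F z' in at z within D1 \<union> D2. v \<in> L z' \<and> c z' v = c z v"
      unfolding at_within_union using 1 2 by (rule eventually_sup[THEN iffD2, OF conjI])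
  qed
  then show ?thesis by blast
qed

text \<open>Where a single chart \<open>u\<close> is valid throughout, \<open>g u v\<close> is a
  flat section by the cocycle identity. Such pieces are glued along segments, which are connected:
  over a thin strip along the second coordinate, then from strip to strip along the first.\<close>

lemma (in group) parallel_section_unit_square:
  fixes L :: "real \<times> real \<Rightarrow> 'i set"
  assumes L: "\<And>z. z \<in> {0..1} \<times> {0..1} \<Longrightarrow> L z \<noteq> {}"
    and L_open: "\<And>z v. z \<in> {0..1} \<times> {0..1} \<Longrightarrow> v \<in> L z \<Longrightarrow> \<forall>\<^sub>F z' in at z within {0..1} \<times> {0..1}. v \<in> L z'"
    and g: "\<And>z v w. z \<in> {0..1} \<times> {0..1} \<Longrightarrow> v \<in> L z \<Longrightarrow> w \<in> L z \<Longrightarrow> g v w \<in> carrier G"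
    and cocycle: "\<And>z u v w. z \<in> {0..1} \<times> {0..1} \<Longrightarrow> u \<in> L z \<Longrightarrow> v \<in> L z \<Longrightarrow> w \<in> L z \<Longrightarrow>
      g u v \<otimes> g v w = g u w"
  shows "\<exists>c. parallel_section G g L ({0..1} \<times> {0..1}) c"
proof -
  let ?I = "{0..1::real}"
  have local: "\<exists>c. parallel_section G g L D c" if D: "D \<subseteq> ?I \<times> ?I" and u: "\<And>z. z \<in> D \<Longrightarrow> u \<in> L z" for D u
  proof -
    have "parallel_section G g L D (\<lambda>z v. g u v)"
      unfolding parallel_section_def
    proof (intro ballI conjI)
      fix z v assume z: "z \<in> D" and v: "v \<in> L z"
      then have z': "z \<in> ?I \<times> ?I" using D by blast
      show "g u v \<in> carrier G" using g[OF z' u[OF z] v] .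
      show "g u w = g u v \<otimes> g v w" if "w \<in> L z" for w using cocycle[OF z' u[OF z] v that] by simp
      show "\<forall>\<^sub>F z' in at z within D. v \<in> L z' \<and> g u v = g u v"
        using filter_leD[OF at_le[OF D] L_open[OF z' v]] by simp
    qed
    then show ?thesis by blast
  qed
  have glue: "\<exists>c. parallel_section G g L (D1 \<union> D2) c"
    if "parallel_section G g L D1 c1" "parallel_section G g L D2 c2" "closed D1" "closed D2"
      "connected (D1 \<inter> D2)" "D1 \<inter> D2 \<noteq> {}" "D1 \<union> D2 \<subseteq> ?I \<times> ?I" for D1 D2 c1 c2
    by (rule parallel_section_glue[OF that(1-6)]) (use that(7) L g in blast)+
  have strip: "\<exists>\<epsilon>>0. \<exists>c. parallel_section G g L (({s-\<epsilon>..s+\<epsilon>} \<inter> ?I) \<times> ?I) c" if s: "s \<in> ?I" for s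
  proof -
    \<comment> \<open>The \<open>Bolzano\<close> rule takes the place of a Lebesgue number: a
      property of intervals that is additive and true near each point holds globally. Its local
      hypothesis ranges over all short real intervals around a point, hence the guard
      \<open>0 \<le> a \<and> b \<le> 1\<close>. The width \<open>\<epsilon>\<close> is part of the
      property because it shrinks when two pieces are glued.\<close>
    have "0 \<le> (0::real) \<and> 1 \<le> (1::real) \<longrightarrow>
      (\<exists>\<epsilon>>0. \<exists>c. parallel_section G g L (({s-\<epsilon>..s+\<epsilon>} \<inter> ?I) \<times> {0..1}) c)"
    proof (rule Bolzano[where P = "\<lambda>a b. 0 \<le> a \<and> b \<le> 1 \<longrightarrow>
        (\<exists>\<epsilon>>0. \<exists>c. parallel_section G g L (({s-\<epsilon>..s+\<epsilon>} \<inter> ?I) \<times> {a..b}) c)"])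
      fix a b c :: real
      assume 1: "0 \<le> a \<and> b \<le> 1 \<longrightarrow> (\<exists>\<epsilon>>0. \<exists>c. parallel_section G g L (({s-\<epsilon>..s+\<epsilon>} \<inter> ?I) \<times> {a..b}) c)"
        and 2: "0 \<le> b \<and> c \<le> 1 \<longrightarrow> (\<exists>\<epsilon>>0. \<exists>d. parallel_section G g L (({s-\<epsilon>..s+\<epsilon>} \<inter> ?I) \<times> {b..c}) d)"
        and abc: "a \<le> b" "b \<le> c"
      show "0 \<le> a \<and> c \<le> 1 \<longrightarrow> (\<exists>\<epsilon>>0. \<exists>d. parallel_section G g L (({s-\<epsilon>..s+\<epsilon>} \<inter> ?I) \<times> {a..c}) d)"
      proof
        assume ac: "0 \<le> a \<and> c \<le> 1"
        obtain \<epsilon>1 c1 where \<epsilon>1: "\<epsilon>1 > 0" and c1: "parallel_section G g L (({s-\<epsilon>1..s+\<epsilon>1} \<inter> ?I) \<times> {a..b}) c1"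
          using 1 ac abc by auto
        obtain \<epsilon>2 c2 where \<epsilon>2: "\<epsilon>2 > 0" and c2: "parallel_section G g L (({s-\<epsilon>2..s+\<epsilon>2} \<inter> ?I) \<times> {b..c}) c2"
          using 2 ac abc by auto
        define \<epsilon> where "\<epsilon> = min \<epsilon>1 \<epsilon>2"
        let ?J = "{s-\<epsilon>..s+\<epsilon>} \<inter> ?I"
        have J: "?J \<subseteq> {s-\<epsilon>1..s+\<epsilon>1} \<inter> ?I" "?J \<subseteq> {s-\<epsilon>2..s+\<epsilon>2} \<inter> ?I" "s \<in> ?J"
          using \<epsilon>1 \<epsilon>2 s by (auto simp: \<epsilon>_def)
        have un: "?J \<times> {a..b} \<union> ?J \<times> {b..c} = ?J \<times> {a..c}" using abc by auto
        have int: "(?J \<times> {a..b}) \<inter> (?J \<times> {b..c}) = ?J \<times> {b}" using abc by auto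
        have "\<exists>d. parallel_section G g L (?J \<times> {a..b} \<union> ?J \<times> {b..c}) d"
        proof (rule glue)
          show "parallel_section G g L (?J \<times> {a..b}) c1"
            by (rule parallel_section_subset[OF c1]) (use J in blast)
          show "parallel_section G g L (?J \<times> {b..c}) c2"
            by (rule parallel_section_subset[OF c2]) (use J in blast)
          show "connected (?J \<times> {a..b} \<inter> ?J \<times> {b..c})"
            unfolding int by (intro connected_Times connected_sing) (simp add: Int_atLeastAtMost connected_Icc)
          show "?J \<times> {a..b} \<inter> ?J \<times> {b..c} \<noteq> {}" unfolding int using J(3) by blast
          show "?J \<times> {a..b} \<union> ?J \<times> {b..c} \<subseteq> ?I \<times> ?I" unfolding un using ac by auto
        qed (intro closed_Times closed_Int; simp)+
        then show "\<exists>\<epsilon>>0. \<exists>d. parallel_section G g L (({s-\<epsilon>..s+\<epsilon>} \<inter> ?I) \<times> {a..c}) d"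
          unfolding un using \<epsilon>1 \<epsilon>2 by (intro exI[of _ \<epsilon>]) (auto simp: \<epsilon>_def)
      qed
    next
      fix x :: real assume "0 \<le> x" "x \<le> 1"
      then have z: "(s, x) \<in> ?I \<times> ?I" using s by auto
      then obtain u where u: "u \<in> L (s, x)" using L by blast
      then obtain d where d: "d > 0" "\<And>z'. z' \<in> ?I \<times> ?I \<Longrightarrow> z' \<noteq> (s, x) \<Longrightarrow> dist z' (s, x) < d \<Longrightarrow> u \<in> L z'"
        using L_open[OF z u] unfolding eventually_at by blast
      show "\<exists>d>0. \<forall>a b. a \<le> x \<and> x \<le> b \<and> b - a < d \<longrightarrow> 0 \<le> a \<and> b \<le> 1 \<longrightarrow>
         (\<exists>\<epsilon>>0. \<exists>c. parallel_section G g L (({s-\<epsilon>..s+\<epsilon>} \<inter> ?I) \<times> {a..b}) c)"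
      \<comment> \<open>With \<open>d/2\<close> allowed in each coordinate, the sum of the two
        differences, which bounds the distance, stays below \<open>d\<close>.\<close>
      proof (rule exI[of _ "d/2"], intro conjI allI impI)
        fix a b assume ab: "a \<le> x \<and> x \<le> b \<and> b - a < d/2" "0 \<le> a \<and> b \<le> 1"
        have "\<exists>c. parallel_section G g L (({s-d/2..s+d/2} \<inter> ?I) \<times> {a..b}) c"
        proof (rule local)
          show "({s-d/2..s+d/2} \<inter> ?I) \<times> {a..b} \<subseteq> ?I \<times> ?I" using ab by auto
          fix z' assume z': "z' \<in> ({s-d/2..s+d/2} \<inter> ?I) \<times> {a..b}"
          obtain p q where pq: "z' = (p, q)" by fastforce
          have "dist z' (s, x) \<le> \<bar>p - s\<bar> + \<bar>q - x\<bar>"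
            using sqrt_sum_squares_le_sum_abs[of "p - s" "q - x"] by (simp add: pq dist_Pair_Pair dist_real_def)
          also have "\<dots> < d" using z' ab unfolding pq by (auto simp: abs_if)
          finally show "u \<in> L z'" using d(2)[of z'] u z' ab by (cases "z' = (s, x)") auto
        qed
        then show "\<exists>\<epsilon>>0. \<exists>c. parallel_section G g L (({s-\<epsilon>..s+\<epsilon>} \<inter> ?I) \<times> {a..b}) c"
          using d(1) by (intro exI[of _ "d/2"]) auto
      qed (use d in simp)
    qed simp
    then show ?thesis by simp
  qed
  have "0 \<le> (0::real) \<and> 1 \<le> (1::real) \<longrightarrow> (\<exists>c. parallel_section G g L ({0..1} \<times> ?I) c)"
  proof (rule Bolzano[where P = "\<lambda>a b. 0 \<le> a \<and> b \<le> 1 \<longrightarrow> (\<exists>c. parallel_section G g L ({a..b} \<times> ?I) c)"])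
    fix a b c :: real
    assume 1: "0 \<le> a \<and> b \<le> 1 \<longrightarrow> (\<exists>c. parallel_section G g L ({a..b} \<times> ?I) c)"
      and 2: "0 \<le> b \<and> c \<le> 1 \<longrightarrow> (\<exists>d. parallel_section G g L ({b..c} \<times> ?I) d)"
      and abc: "a \<le> b" "b \<le> c"
    show "0 \<le> a \<and> c \<le> 1 \<longrightarrow> (\<exists>d. parallel_section G g L ({a..c} \<times> ?I) d)"
    proof
      assume ac: "0 \<le> a \<and> c \<le> 1"
      obtain c1 c2 where c1: "parallel_section G g L ({a..b} \<times> ?I) c1"
        and c2: "parallel_section G g L ({b..c} \<times> ?I) c2"
        using 1 2 ac abc by auto
      have un: "{a..b} \<times> ?I \<union> {b..c} \<times> ?I = {a..c} \<times> ?I" using abc by auto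
      have int: "({a..b} \<times> ?I) \<inter> ({b..c} \<times> ?I) = {b} \<times> ?I" using abc by auto
      have "\<exists>d. parallel_section G g L ({a..b} \<times> ?I \<union> {b..c} \<times> ?I) d"
      proof (rule glue[OF c1 c2])
        show "connected ({a..b} \<times> ?I \<inter> {b..c} \<times> ?I)"
          unfolding int by (intro connected_Times connected_sing connected_Icc)
        show "{a..b} \<times> ?I \<inter> {b..c} \<times> ?I \<noteq> {}" unfolding int by auto
        show "{a..b} \<times> ?I \<union> {b..c} \<times> ?I \<subseteq> ?I \<times> ?I" unfolding un using ac by auto
      qed (intro closed_Times; simp)+
      then show "\<exists>d. parallel_section G g L ({a..c} \<times> ?I) d" unfolding un .
    qed
  next
    fix x :: real assume "0 \<le> x" "x \<le> 1"
    then obtain \<epsilon> c where \<epsilon>: "\<epsilon> > 0" "parallel_section G g L (({x-\<epsilon>..x+\<epsilon>} \<inter> ?I) \<times> ?I) c"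
      using strip[of x] by auto
    show "\<exists>d>0. \<forall>a b. a \<le> x \<and> x \<le> b \<and> b - a < d \<longrightarrow> 0 \<le> a \<and> b \<le> 1 \<longrightarrow>
        (\<exists>c. parallel_section G g L ({a..b} \<times> ?I) c)"
    proof (intro exI[of _ \<epsilon>] conjI allI impI)
      fix a b assume "a \<le> x \<and> x \<le> b \<and> b - a < \<epsilon>" "0 \<le> a \<and> b \<le> 1"
      then have "{a..b} \<subseteq> {x-\<epsilon>..x+\<epsilon>} \<inter> ?I" by auto
      then have "{a..b} \<times> ?I \<subseteq> ({x-\<epsilon>..x+\<epsilon>} \<inter> ?I) \<times> ?I" by blast
      then show "\<exists>c. parallel_section G g L ({a..b} \<times> ?I) c"
        using parallel_section_subset[OF \<epsilon>(2)] by blast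
    qed (use \<epsilon> in simp)
  qed simp
  then show ?thesis by simp
qed

subsection \<open>Group-valued functors on paths\<close>

text \<open>A functor from the fundamental groupoid of \<open>X\<close> to a group seen as a
  groupoid with one object. Preservation of identities follows, since an idempotent of a group is
  trivial.\<close>

locale path_functor = group G for G (structure) +
  fixes X :: "'x topology" and r :: "(real \<Rightarrow> 'x) \<Rightarrow> 'a"
  assumes closed: "pathin X p \<Longrightarrow> r p \<in> carrier G"
    and join: "pathin X p \<Longrightarrow> pathin X q \<Longrightarrow> p 1 = q 0 \<Longrightarrow> r (path_join p q) = r p \<otimes> r q"
    and homotopic: "path_homotopic X p q \<Longrightarrow> r p = r q"
begin

lemma const:
  assumes "x \<in> topspace X" shows "r (\<lambda>_. x) = \<one>"
proof -
  have p: "pathin X (\<lambda>_. x)" using assms by (simp add: pathin_def)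
  have "path_join (\<lambda>_. x) (\<lambda>_. x) = (\<lambda>_::real. x)" by (simp add: path_join_def)
  then have "r (\<lambda>_. x) \<otimes> r (\<lambda>_. x) = r (\<lambda>_. x)" using join[OF p p] by simp
  then show ?thesis using closed[OF p] by simp
qed

lemma reverse:
  assumes p: "pathin X p" shows "r (path_reverse p) = inv r p"
proof -
  have "p 1 \<in> topspace X" using p by (auto simp: pathin_def continuous_map_def)
  then have "r (path_reverse p) \<otimes> r p = \<one>"
    using join[OF pathin_reverse[OF p] p] homotopic[OF path_join_reverse_left[OF p]] const
    by (simp add: path_reverse_def)
  then show ?thesis using closed[OF p] closed[OF pathin_reverse[OF p]] by (simp add: inv_equality)
qed

text \<open>\<open>p\<close> followed by the reverse of \<open>q\<close> is a loop in
  \<open>S\<close>.\<close>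

lemma eq_if_small:
  assumes small: "\<And>\<gamma>. pathin X \<gamma> \<Longrightarrow> \<gamma> 0 = \<gamma> 1 \<Longrightarrow> \<gamma> ` {0..1} \<subseteq> S \<Longrightarrow> r \<gamma> = \<one>"
    and p: "pathin X p" "p ` {0..1} \<subseteq> S" and q: "pathin X q" "q ` {0..1} \<subseteq> S"
    and ends: "p 0 = q 0" "p 1 = q 1"
  shows "r p = r q"
proof -
  have "path_join p (path_reverse q) ` {0..1} \<subseteq> S"
  proof (rule image_subsetI)
    fix t :: real assume "t \<in> {0..1}"
    then show "path_join p (path_reverse q) t \<in> S"
      using subsetD[OF p(2), OF imageI[of "2 * t"]] subsetD[OF q(2), OF imageI[of "1 - (2 * t - 1)"]]
      by (auto simp: path_join_def path_reverse_def)
  qed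
  moreover have "pathin X (path_join p (path_reverse q))"
    using p(1) pathin_reverse[OF q(1)] ends(2) by (intro pathin_join) (simp_all add: path_reverse_def)
  moreover have "path_join p (path_reverse q) 0 = path_join p (path_reverse q) 1"
    using ends(1) by (simp add: path_join_def path_reverse_def)
  ultimately have "r (path_join p (path_reverse q)) = \<one>" by (intro small)
  then have "r p \<otimes> inv r q = \<one>"
    using join[OF p(1) pathin_reverse[OF q(1)]] reverse[OF q(1)] ends(2) by (simp add: path_reverse_def)
  then show ?thesis using closed[OF p(1)] closed[OF q(1)] by (metis inv_closed inv_equality inv_inv)
qed

lemma path_segment_join:
  assumes p: "pathin X p" and abc: "0 \<le> a" "a \<le> b" "b \<le> c" "c \<le> 1"
  shows "r (path_segment a c p) = r (path_segment a b p) \<otimes> r (path_segment b c p)"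
  using homotopic[OF path_homotopic_join_path_segment[OF assms]]
    join[OF pathin_path_segment[OF p] pathin_path_segment[OF p]] abc
  by (auto simp: path_segment_def)

text \<open>Inside \<open>P v\<close> the functor is a coboundary,
  \<open>r \<eta> = e v x \<otimes> inv (e v y)\<close> for \<open>\<eta>\<close> from
  \<open>x\<close> to \<open>y\<close>, and \<open>g u v\<close> compares two such trivializations.
  The null-homotopy spreads the resulting bundle over the square, where it has a flat section
  \<open>c\<close>. Along the side \<open>s = 0\<close>, which carries
  \<open>p \<circ> \<alpha>\<close>, the sections \<open>e\<close> and \<open>c\<close> differ by a
  function \<open>F\<close> with \<open>r \<alpha> = F 0 \<otimes> inv F 1\<close>.\<close>

lemma trivial_if_null_in_nerve:
  assumes \<alpha>: "pathin X \<alpha>" "\<alpha> 0 = x0" "\<alpha> 1 = x0"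
    and p_star: "\<And>v x. v \<in> \<V> \<Longrightarrow> x \<in> topspace X \<Longrightarrow> p x \<in> open_star (nerve \<V>) v \<Longrightarrow> x \<in> v"
    and null: "path_homotopic (geometric_realization (nerve \<V>)) (p \<circ> \<alpha>) (\<lambda>_. vertex_point v0)"
    and P: "\<And>v. v \<in> \<V> \<Longrightarrow> v \<subseteq> P v" "\<And>v. v \<in> \<V> \<Longrightarrow> path_connectedin X (P v)"
    and small: "\<And>u v \<gamma>. u \<in> \<V> \<Longrightarrow> v \<in> \<V> \<Longrightarrow> P u \<inter> P v \<noteq> {} \<Longrightarrow> pathin X \<gamma> \<Longrightarrow> \<gamma> 0 = \<gamma> 1 \<Longrightarrow>
        \<gamma> ` {0..1} \<subseteq> P u \<union> P v \<Longrightarrow> r \<gamma> = \<one>"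
  shows "r \<alpha> = \<one>"
proof -
  let ?R = "geometric_realization (nerve \<V>)" and ?I = "{0..1::real}"
  define b where "b v = (SOME x. x \<in> P v)" for v
  have b: "b v \<in> P v" if "x \<in> P v" for x v
    unfolding b_def using that by (rule someI)
  have joining: "\<exists>\<eta>. pathin X \<eta> \<and> \<eta> 0 = x \<and> \<eta> 1 = y \<and> \<eta> ` ?I \<subseteq> P v"
    if "v \<in> \<V>" "x \<in> P v" "y \<in> P v" for v x y
    using P(2)[OF that(1)] that(2,3) unfolding path_connectedin by (metis image_subset_iff_funcset)
  \<comment> \<open>Any path inside \<open>P v\<close> from \<open>x\<close> to \<open>b v\<close>
    gives the same value: the smallness assumption with \<open>u = v\<close> kills the loop formed
    by two of them.\<close>
  define e where "e v x = r (SOME \<eta>. pathin X \<eta> \<and> \<eta> 0 = x \<and> \<eta> 1 = b v \<and> \<eta> ` ?I \<subseteq> P v)" for v x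
  have e: "e v x = r \<eta>" if v: "v \<in> \<V>" and \<eta>: "pathin X \<eta>" "\<eta> 0 = x" "\<eta> 1 = b v" "\<eta> ` ?I \<subseteq> P v" for v x \<eta>
  proof -
    define \<zeta> where "\<zeta> = (SOME \<eta>. pathin X \<eta> \<and> \<eta> 0 = x \<and> \<eta> 1 = b v \<and> \<eta> ` ?I \<subseteq> P v)"
    have \<zeta>: "pathin X \<zeta> \<and> \<zeta> 0 = x \<and> \<zeta> 1 = b v \<and> \<zeta> ` ?I \<subseteq> P v"
      unfolding \<zeta>_def by (rule someI[of _ \<eta>]) (use \<eta> in simp)
    have "\<eta> 0 \<in> P v" using \<eta>(4) by auto
    then have "r \<zeta> = r \<eta>"
      by (intro eq_if_small[of "P v"] small[OF v v]) (use \<zeta> \<eta> in auto)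
    then show ?thesis unfolding e_def \<zeta>_def .
  qed
  have e_closed: "e v x \<in> carrier G" if "v \<in> \<V>" "x \<in> P v" for v x
    using joining[OF that b[OF that(2)]] e[OF that(1)] closed by metis
  have e_path: "r \<eta> \<otimes> e v y = e v x"
    if v: "v \<in> \<V>" and \<eta>: "pathin X \<eta>" "\<eta> 0 = x" "\<eta> 1 = y" "\<eta> ` ?I \<subseteq> P v" for v x y \<eta>
  proof -
    have y: "y \<in> P v" using \<eta>(3,4) by auto
    obtain \<zeta> where \<zeta>: "pathin X \<zeta>" "\<zeta> 0 = y" "\<zeta> 1 = b v" "\<zeta> ` ?I \<subseteq> P v"
      using joining[OF v y b[OF y]] by blast
    have "path_join \<eta> \<zeta> ` ?I \<subseteq> P v"
    proof (rule image_subsetI)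
      fix t :: real assume "t \<in> ?I"
      then show "path_join \<eta> \<zeta> t \<in> P v"
        using subsetD[OF \<eta>(4), OF imageI[of "2 * t"]] subsetD[OF \<zeta>(4), OF imageI[of "2 * t - 1"]]
        by (auto simp: path_join_def)
    qed
    moreover have "pathin X (path_join \<eta> \<zeta>)" using \<eta> \<zeta> by (intro pathin_join) auto
    ultimately have "e v x = r (path_join \<eta> \<zeta>)"
      by (intro e[OF v]) (use \<eta> \<zeta> in \<open>auto simp: path_join_def\<close>)
    also have "\<dots> = r \<eta> \<otimes> r \<zeta>" using \<eta> \<zeta> by (intro join) auto
    also have "r \<zeta> = e v y" using e[OF v \<zeta>] ..
    finally show ?thesis ..
  qed
  \<comment> \<open>The choice of \<open>y\<close> is immaterial: moving it to \<open>x\<close>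
    inside \<open>P u\<close> or inside \<open>P v\<close> changes both factors by the same value of
    \<open>r\<close>, as loops in \<open>P u \<union> P v\<close> are killed. For disjoint
    \<open>P u\<close> and \<open>P v\<close> the value is arbitrary.\<close>
  define g where "g u v = (let y = SOME y. y \<in> P u \<inter> P v in inv e u y \<otimes> e v y)" for u v
  have g: "g u v = inv e u x \<otimes> e v x" if u: "u \<in> \<V>" and v: "v \<in> \<V>" and x: "x \<in> P u" "x \<in> P v" for u v x
  proof -
    define y where "y = (SOME y. y \<in> P u \<inter> P v)"
    have y: "y \<in> P u \<inter> P v" unfolding y_def by (rule someI[of _ x]) (use x in blast)
    obtain \<eta> where \<eta>: "pathin X \<eta>" "\<eta> 0 = x" "\<eta> 1 = y" "\<eta> ` ?I \<subseteq> P u"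
      using joining[OF u x(1)] y by blast
    obtain \<zeta> where \<zeta>: "pathin X \<zeta>" "\<zeta> 0 = x" "\<zeta> 1 = y" "\<zeta> ` ?I \<subseteq> P v"
      using joining[OF v x(2)] y by blast
    have eq: "r \<eta> = r \<zeta>"
      by (intro eq_if_small[of "P u \<union> P v"] small[OF u v]) (use \<eta> \<zeta> x in auto)
    have car: "e u y \<in> carrier G" "e v y \<in> carrier G" "r \<zeta> \<in> carrier G"
      using e_closed u v y closed \<zeta>(1) by auto
    have "inv e u x \<otimes> e v x = inv (r \<zeta> \<otimes> e u y) \<otimes> (r \<zeta> \<otimes> e v y)"
      using e_path[OF u \<eta>] e_path[OF v \<zeta>] eq by simp
    also have "\<dots> = inv e u y \<otimes> e v y"
      using car by (simp add: inv_mult_group m_assoc inv_cancel_left)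
    finally show ?thesis unfolding g_def y_def[symmetric] Let_def by simp
  qed
  obtain h where h: "continuous_map (prod_topology (top_of_set ?I) (top_of_set ?I)) ?R h"
     "\<And>t. h (0, t) = p (\<alpha> t)" "\<And>t. h (1, t) = vertex_point v0"
     "\<And>s. s \<in> ?I \<Longrightarrow> h (s, 0) = p (\<alpha> 0)" "\<And>s. s \<in> ?I \<Longrightarrow> h (s, 1) = p (\<alpha> 1)"
    using null unfolding path_homotopic_def homotopic_with_def by force
  have h_cont: "continuous_map (top_of_set (?I \<times> ?I)) ?R h"
    using h(1) by (simp add: prod_topology_subtopology_eu)
  have hR: "h z \<in> topspace ?R" if "z \<in> ?I \<times> ?I" for z
    using continuous_map_image_subset_topspace[OF h_cont] that by auto
  have v0: "p (\<alpha> 0) = vertex_point v0" using h(3)[of 0] h(4)[of 1] by simp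
  \<comment> \<open>The charts at \<open>z\<close> are the vertices with positive coordinate in
    \<open>h z\<close>; they make sense also where \<open>h z\<close> is not in the image of
    \<open>p\<close>.\<close>
  define L where "L z = {v. h z \<in> open_star (nerve \<V>) v}" for z
  have L_V: "L z \<subseteq> \<V>" and L_Int: "\<exists>x. \<forall>v\<in>L z. x \<in> P v" if z: "z \<in> ?I \<times> ?I" for z
  proof -
    show sub: "L z \<subseteq> \<V>" using open_star_nerve_Inter(2)[OF hR[OF z]] by (simp add: L_def)
    obtain x where "\<forall>v\<in>L z. x \<in> v" using open_star_nerve_Inter(1)[OF hR[OF z]] by (auto simp: L_def)
    then show "\<exists>x. \<forall>v\<in>L z. x \<in> P v" using P(1) sub by blast
  qed
  have g_closed: "g v w \<in> carrier G" if z: "z \<in> ?I \<times> ?I" "v \<in> L z" "w \<in> L z" for z v w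
  proof -
    obtain x where "x \<in> P v" "x \<in> P w" "v \<in> \<V>" "w \<in> \<V>" using L_Int[OF z(1)] L_V[OF z(1)] z by blast
    then show ?thesis using g e_closed by simp
  qed
  have "\<exists>c. parallel_section G g L (?I \<times> ?I) c"
  proof (rule parallel_section_unit_square)
    show "L z \<noteq> {}" if "z \<in> ?I \<times> ?I" for z
      using ex_open_star[OF hR[OF that] finite_nerve[where \<U> = \<V>]] by (auto simp: L_def)
    show "\<forall>\<^sub>F z' in at z within ?I \<times> ?I. v \<in> L z'" if z: "z \<in> ?I \<times> ?I" "v \<in> L z" for z v
    proof -
      have "openin (top_of_set (?I \<times> ?I)) {z \<in> ?I \<times> ?I. h z \<in> open_star (nerve \<V>) v}"
        using openin_continuous_map_preimage[OF h_cont openin_open_star] by simp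
      then obtain T where T: "open T" "{z \<in> ?I \<times> ?I. h z \<in> open_star (nerve \<V>) v} = ?I \<times> ?I \<inter> T"
        unfolding openin_open by blast
      then show ?thesis unfolding eventually_at_topological using z
        by (intro exI[of _ T]) (auto simp: L_def)
    qed
    show "g v w \<in> carrier G" if "z \<in> ?I \<times> ?I" "v \<in> L z" "w \<in> L z" for z v w
      using g_closed that .
    show "g u v \<otimes> g v w = g u w" if z: "z \<in> ?I \<times> ?I" and uvw: "u \<in> L z" "v \<in> L z" "w \<in> L z" for z u v w
    proof -
      obtain x where x: "x \<in> P u" "x \<in> P v" "x \<in> P w" using L_Int[OF z] uvw by blast
      have V: "u \<in> \<V>" "v \<in> \<V>" "w \<in> \<V>" using L_V[OF z] uvw by auto
      have car: "e u x \<in> carrier G" "e v x \<in> carrier G" "e w x \<in> carrier G" using e_closed V x by auto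
      then show ?thesis using g V x by (simp add: m_assoc inv_cancel_left)
    qed
  qed
  then obtain c where c: "parallel_section G g L (?I \<times> ?I) c" by blast
  have v0_L: "v0 \<in> L z" if "z \<in> ?I \<times> ?I" "h z = vertex_point v0" for z
    using hR[OF that(1)] that(2) by (simp add: L_def open_star_def vertex_point_def)
  \<comment> \<open>The ends are joined along the other three sides, where \<open>h\<close> rests at
    the base vertex and \<open>v0\<close> is therefore a chart throughout.\<close>
  have c_ends: "c (0, 0) v0 = c (0, 1) v0"
  proof (rule parallel_section_const[OF c])
    let ?E = "(?I \<times> {0} \<union> {1} \<times> ?I) \<union> ?I \<times> {1}"
    have "(1, 0) \<in> ?I \<times> {0::real} \<inter> {1::real} \<times> ?I" "(1, 1) \<in> (?I \<times> {0} \<union> {1} \<times> ?I) \<inter> ?I \<times> {1::real}" by auto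
    then show "connected ?E"
      by (intro connected_Un connected_Times connected_sing connected_Icc) blast+
    show "v0 \<in> L z" if "z \<in> ?E" for z
    proof (rule v0_L)
      show "z \<in> ?I \<times> ?I" using that by auto
      show "h z = vertex_point v0" using that h v0 \<alpha>(2,3) by auto
    qed
  qed auto
  \<comment> \<open>Along \<open>\<alpha>\<close> the two flat sections \<open>e\<close> and \<open>c\<close> change chart by the same \<open>g\<close>, so \<open>F\<close> is chart-free.\<close>
  define F where "F t = (let v = SOME v. v \<in> L (0, t) in e v (\<alpha> t) \<otimes> inv c (0, t) v)" for t
  have \<alpha>X: "\<alpha> t \<in> topspace X" if "t \<in> ?I" for t
    using continuous_map_image_subset_topspace[OF \<alpha>(1)[unfolded pathin_def]] that by auto
  have \<alpha>_L: "v \<in> \<V>" "\<alpha> t \<in> P v" if t: "t \<in> ?I" and v: "v \<in> L (0, t)" for t v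
  proof -
    show V: "v \<in> \<V>" using L_V[of "(0, t)"] t v by auto
    have "\<alpha> t \<in> v" using p_star[OF V \<alpha>X[OF t]] v h(2) by (simp add: L_def)
    then show "\<alpha> t \<in> P v" using P(1)[OF V] by blast
  qed
  have F: "F t = e v (\<alpha> t) \<otimes> inv c (0, t) v" if t: "t \<in> ?I" and v: "v \<in> L (0, t)" for t v
  proof -
    have z: "(0, t) \<in> ?I \<times> ?I" using t by simp
    define w where "w = (SOME v. v \<in> L (0, t))"
    have w: "w \<in> L (0, t)" unfolding w_def using v by (rule someI)
    have car: "e v (\<alpha> t) \<in> carrier G" "e w (\<alpha> t) \<in> carrier G" "c (0, t) v \<in> carrier G"
      using e_closed \<alpha>_L t v w parallel_sectionD(1)[OF c z v] by auto
    have gvw: "g v w = inv e v (\<alpha> t) \<otimes> e w (\<alpha> t)"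
      by (rule g) (use \<alpha>_L t v w in auto)
    have "F t = e w (\<alpha> t) \<otimes> inv c (0, t) w" by (simp add: F_def w_def Let_def)
    also have "c (0, t) w = c (0, t) v \<otimes> (inv e v (\<alpha> t) \<otimes> e w (\<alpha> t))"
      using parallel_sectionD(2)[OF c z v w] gvw by simp
    also have "e w (\<alpha> t) \<otimes> inv (c (0, t) v \<otimes> (inv e v (\<alpha> t) \<otimes> e w (\<alpha> t))) =
        e v (\<alpha> t) \<otimes> inv c (0, t) v"
      using car by (simp add: inv_mult_group m_assoc inv_cancel_left)
    finally show ?thesis .
  qed
  have L_ne: "\<exists>v. v \<in> L (0, t)" if "t \<in> ?I" for t
    using ex_open_star[OF hR[of "(0, t)"] finite_nerve[where \<U> = \<V>]] that by (auto simp: L_def)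
  have F_closed: "F t \<in> carrier G" if t: "t \<in> ?I" for t
  proof -
    obtain v where v: "v \<in> L (0, t)" using L_ne[OF t] by blast
    then show ?thesis using F[OF t v] e_closed[OF \<alpha>_L[OF t v]] parallel_sectionD(1)[OF c _ v] t by simp
  qed
  \<comment> \<open>\<open>F a \<otimes> inv F b\<close> telescopes under subdivision, so short
    segments suffice. On these one chart \<open>v\<close> is valid and \<open>c\<close> is constant
    in it, and \<open>r\<close> of the segment is exactly the change of \<open>e v\<close>.\<close>
  have "0 \<le> (0::real) \<and> 1 \<le> (1::real) \<longrightarrow> r (path_segment 0 1 \<alpha>) = F 0 \<otimes> inv F 1"
  proof (rule Bolzano[where P = "\<lambda>a b. 0 \<le> a \<and> b \<le> 1 \<longrightarrow> r (path_segment a b \<alpha>) = F a \<otimes> inv F b"])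
    fix x y z :: real
    assume 1: "0 \<le> x \<and> y \<le> 1 \<longrightarrow> r (path_segment x y \<alpha>) = F x \<otimes> inv F y"
      and 2: "0 \<le> y \<and> z \<le> 1 \<longrightarrow> r (path_segment y z \<alpha>) = F y \<otimes> inv F z"
      and le: "x \<le> y" "y \<le> z"
    show "0 \<le> x \<and> z \<le> 1 \<longrightarrow> r (path_segment x z \<alpha>) = F x \<otimes> inv F z"
    proof
      assume xz: "0 \<le> x \<and> z \<le> 1"
      have car: "F x \<in> carrier G" "F y \<in> carrier G" "F z \<in> carrier G" using F_closed xz le by auto
      have "r (path_segment x z \<alpha>) = F x \<otimes> inv F y \<otimes> (F y \<otimes> inv F z)"
        using path_segment_join[OF \<alpha>(1), of x y z] 1 2 xz le by simp
      also have "\<dots> = F x \<otimes> inv F z" using car by (simp add: m_assoc inv_cancel_left)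
      finally show "r (path_segment x z \<alpha>) = F x \<otimes> inv F z" .
    qed
  next
    fix x :: real assume x: "0 \<le> x" "x \<le> 1"
    then obtain v where v: "v \<in> L (0, x)" using L_ne[of x] by auto
    have "(0, x) \<in> ?I \<times> ?I" using x by simp
    from parallel_sectionD(3)[OF c this v] obtain d where d: "d > 0"
      "\<And>z. z \<in> ?I \<times> ?I \<Longrightarrow> z \<noteq> (0, x) \<Longrightarrow> dist z (0, x) < d \<Longrightarrow> v \<in> L z \<and> c z v = c (0, x) v"
      unfolding eventually_at by blast
    have near: "v \<in> L (0, t)" "c (0, t) v = c (0, x) v" if "t \<in> ?I" "\<bar>t - x\<bar> < d" for t
      using d(2)[of "(0, t)"] that v by (cases "t = x"; simp add: dist_Pair_Pair dist_real_def)+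
    show "\<exists>d>0. \<forall>a b. a \<le> x \<and> x \<le> b \<and> b - a < d \<longrightarrow> 0 \<le> a \<and> b \<le> 1 \<longrightarrow>
        r (path_segment a b \<alpha>) = F a \<otimes> inv F b"
    proof (rule exI[of _ d], intro conjI allI impI)
      fix a b assume ab: "a \<le> x \<and> x \<le> b \<and> b - a < d" "0 \<le> a \<and> b \<le> 1"
      have aI: "a \<in> ?I" "\<bar>a - x\<bar> < d" and bI: "b \<in> ?I" "\<bar>b - x\<bar> < d" using ab by auto
      have V: "v \<in> \<V>" using \<alpha>_L(1)[OF aI(1)] near(1)[OF aI] by blast
      have "path_segment a b \<alpha> ` ?I \<subseteq> P v"
      proof (rule image_subsetI)
        fix t :: real assume "t \<in> ?I"
        then obtain s where s: "s \<in> {a..b}" "path_segment a b \<alpha> t = \<alpha> s" using path_segment_image[of a b t \<alpha>] ab by auto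
        then have "s \<in> ?I" "\<bar>s - x\<bar> < d" using ab by auto
        then show "path_segment a b \<alpha> t \<in> P v" using \<alpha>_L(2) near(1) s(2) by simp
      qed
      then have e_ab: "r (path_segment a b \<alpha>) \<otimes> e v (\<alpha> b) = e v (\<alpha> a)"
        by (intro e_path[OF V pathin_path_segment[OF \<alpha>(1) aI(1) bI(1)]]) (simp_all add: path_segment_def)
      have car: "r (path_segment a b \<alpha>) \<in> carrier G" "e v (\<alpha> b) \<in> carrier G" "c (0, x) v \<in> carrier G"
        using closed[OF pathin_path_segment[OF \<alpha>(1) aI(1) bI(1)]] e_closed[OF \<alpha>_L[OF bI(1) near(1)[OF bI]]]
          parallel_sectionD(1)[OF c _ v] x by auto
      have Fb: "F b = e v (\<alpha> b) \<otimes> inv c (0, x) v" using F[OF bI(1) near(1)[OF bI]] near(2)[OF bI] by simp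
      have "F a = r (path_segment a b \<alpha>) \<otimes> F b"
        using F[OF aI(1) near(1)[OF aI]] near(2)[OF aI] Fb e_ab car by (simp add: m_assoc[symmetric])
      then show "r (path_segment a b \<alpha>) = F a \<otimes> inv F b"
        using car F_closed[OF bI(1)] by (simp add: m_assoc)
    qed (use d in simp)
  qed simp
  then have "r \<alpha> = F 0 \<otimes> inv F 1" by (simp add: path_segment_def)
  moreover have "F 0 = F 1"
  proof -
    have "v0 \<in> L (0, 0)" "v0 \<in> L (0, 1)" using v0_L h(4)[of 0] h(5)[of 0] v0 \<alpha>(2,3) by auto
    then show ?thesis using F c_ends \<alpha>(2,3) by simp
  qed
  ultimately show ?thesis using F_closed[of 1] by simp
qed

end

subsection \<open>Spanier groups and the kernel of the shape map\<close>

text \<open>The constant path at \<open>x0\<close> is prescribed so that closing up a loop at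
  \<open>x0\<close> does not change its class.\<close>

locale base_paths =
  fixes X :: "'a topology" and x0 :: 'a and \<tau> :: "'a \<Rightarrow> real \<Rightarrow> 'a"
  assumes base: "x0 \<in> topspace X" "\<tau> x0 = (\<lambda>_. x0)"
    and \<tau>: "\<And>x. x \<in> topspace X \<Longrightarrow> pathin X (\<tau> x) \<and> \<tau> x 0 = x0 \<and> \<tau> x 1 = x"
begin

definition close_up :: "(real \<Rightarrow> 'a) \<Rightarrow> real \<Rightarrow> 'a" where
  "close_up p = path_join (path_join (\<tau> (p 0)) p) (path_reverse (\<tau> (p 1)))"

lemma close_up_loops: "pathin X p \<Longrightarrow> close_up p \<in> loops X x0"
  unfolding loops_def close_up_def using \<tau> pathin_in_topspace[of X p]
  by (auto intro!: pathin_join pathin_reverse)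

text \<open>For composable paths the return path of the first and the outgoing path of the second
  are the same \<open>\<tau> (q 0)\<close> and cancel.\<close>

lemma path_functor_close_up:
  "path_functor (fundamental_group X x0) X (\<lambda>p. path_class X (close_up p))"
proof (intro path_functor.intro path_functor_axioms.intro)
  show "group (fundamental_group X x0)" by (rule group_fundamental_group[OF base(1)])
  show "path_class X (close_up p) \<in> carrier (fundamental_group X x0)" if "pathin X p" for p
    using close_up_loops[OF that] by (simp add: fundamental_group_def)
  show "path_class X (close_up p) = path_class X (close_up q)" if pq: "path_homotopic X p q" for p q
  proof (rule path_class_eqI)
    have p: "pathin X p" and ends: "q 0 = p 0" "q 1 = p 1"
      using path_homotopic_imp_pathin(1)[OF pq] path_homotopic_ends[OF pq] .
    then show "path_homotopic X (close_up p) (close_up q)"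
      unfolding close_up_def ends using pq \<tau> pathin_in_topspace[of X p]
      by (intro path_homotopic_join path_homotopic_refl pathin_reverse) auto
  qed
  show "path_class X (close_up (path_join p q)) =
      path_class X (close_up p) \<otimes>\<^bsub>fundamental_group X x0\<^esub> path_class X (close_up q)"
    if p: "pathin X p" and q: "pathin X q" and pq: "p 1 = q 0" for p q
    unfolding mult_fundamental_group[OF close_up_loops[OF p] close_up_loops[OF q]]
  proof (rule path_class_eqI, rule path_homotopic_sym)
    let ?a = "\<tau> (p 0)" and ?b = "\<tau> (q 0)" and ?c = "path_reverse (\<tau> (q 1))"
    have a: "pathin X ?a" "?a 1 = p 0" and b: "pathin X ?b" "?b 1 = q 0" "?b 0 = x0"
      and c: "pathin X ?c" "?c 0 = q 1"
      using \<tau>[OF pathin_in_topspace[OF p, of 0]] \<tau>[OF pathin_in_topspace[OF q, of 0]]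
        \<tau>[OF pathin_in_topspace[OF q, of 1]] by (auto intro!: pathin_reverse)
    note J = pathin_join path_homotopic_refl path_homotopic_join pathin_reverse
    have "path_homotopic X (path_join (path_join (path_join ?a p) (path_reverse ?b)) (path_join (path_join ?b q) ?c))
        (path_join (path_join ?a p) (path_join (path_reverse ?b) (path_join (path_join ?b q) ?c)))"
      by (rule path_join_assoc) (use a b c p q pq in \<open>auto intro!: J\<close>)
    moreover have "path_homotopic X \<dots> (path_join (path_join ?a p) (path_join q ?c))"
    proof (rule path_homotopic_join)
      have "path_homotopic X (path_join (path_reverse ?b) (path_join (path_join ?b q) ?c))
          (path_join (path_reverse ?b) (path_join ?b (path_join q ?c)))"
        by (rule path_homotopic_join[OF path_homotopic_refl path_join_assoc])
          (use b c q in \<open>auto intro!: J\<close>)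
      moreover have "path_homotopic X \<dots> (path_join q ?c)"
        by (rule path_join_reverse_cancel) (use b c q in \<open>auto intro!: J\<close>)
      ultimately show "path_homotopic X (path_join (path_reverse ?b) (path_join (path_join ?b q) ?c)) (path_join q ?c)"
        by (rule path_homotopic_trans)
    qed (use a b p pq in \<open>auto intro!: J\<close>)
    moreover have "path_homotopic X \<dots> (path_join (path_join (path_join ?a p) q) ?c)"
      by (rule path_homotopic_sym, rule path_join_assoc) (use a c p q pq in \<open>auto intro!: J\<close>)
    moreover have "path_homotopic X \<dots> (path_join (path_join ?a (path_join p q)) ?c)"
      by (rule path_homotopic_join[OF path_join_assoc path_homotopic_refl])
        (use a c p q pq in \<open>auto intro!: J\<close>)
    ultimately show "path_homotopic X (path_join (close_up p) (close_up q)) (close_up (path_join p q))"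
      unfolding close_up_def path_join_ends pq by (blast intro: path_homotopic_trans)
  qed
qed

lemma close_up_loop:
  assumes "p \<in> loops X x0" shows "path_class X (close_up p) = path_class X p"
proof (rule path_class_eqI)
  have p: "pathin X p" "p 0 = x0" "p 1 = x0" using assms by (auto simp: loops_def)
  have const: "path_reverse (\<lambda>_. x0) = (\<lambda>_. x0)" "pathin X (\<lambda>_. x0)"
    using base(1) by (auto simp: path_reverse_def pathin_def)
  have 1: "path_homotopic X (path_join (\<lambda>_. x0) p) p" using path_join_const_left[OF p(1)] p by simp
  have "path_homotopic X (path_join (path_join (\<lambda>_. x0) p) (\<lambda>_. x0)) (path_join p (\<lambda>_. x0))"
    by (rule path_homotopic_join[OF 1 path_homotopic_refl]) (use const p in auto)
  moreover have "path_homotopic X (path_join p (\<lambda>_. x0)) p" using path_join_const_right[OF p(1)] p by simp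
  ultimately show "path_homotopic X (close_up p) p"
    unfolding close_up_def p(2,3) base(2) const(1) by (rule path_homotopic_trans)
qed

text \<open>Closing up turns conjugation by a path into conjugation in the group.\<close>

lemma spanier_generator_eq:
  assumes \<alpha>: "pathin X \<alpha>" "\<alpha> 0 = x0" and \<gamma>: "\<gamma> \<in> loops X (\<alpha> 1)"
  shows "path_class X (path_join (path_join \<alpha> \<gamma>) (path_reverse \<alpha>)) =
    path_class X (close_up \<alpha>) \<otimes>\<^bsub>fundamental_group X x0\<^esub> path_class X (close_up \<gamma>)
      \<otimes>\<^bsub>fundamental_group X x0\<^esub> inv\<^bsub>fundamental_group X x0\<^esub> path_class X (close_up \<alpha>)"
    and "path_join (path_join \<alpha> \<gamma>) (path_reverse \<alpha>) \<in> loops X x0"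
proof -
  interpret F: path_functor "fundamental_group X x0" X "\<lambda>p. path_class X (close_up p)"
    by (rule path_functor_close_up)
  have \<gamma>': "pathin X \<gamma>" "\<gamma> 0 = \<alpha> 1" "\<gamma> 1 = \<alpha> 1" using \<gamma> by (auto simp: loops_def)
  have j: "pathin X (path_join \<alpha> \<gamma>)" using \<alpha> \<gamma>' by (intro pathin_join) auto
  show loop: "path_join (path_join \<alpha> \<gamma>) (path_reverse \<alpha>) \<in> loops X x0"
    using \<alpha> \<gamma>' j by (auto simp: loops_def intro!: pathin_join pathin_reverse)
  show "path_class X (path_join (path_join \<alpha> \<gamma>) (path_reverse \<alpha>)) =
    path_class X (close_up \<alpha>) \<otimes>\<^bsub>fundamental_group X x0\<^esub> path_class X (close_up \<gamma>)
      \<otimes>\<^bsub>fundamental_group X x0\<^esub> inv\<^bsub>fundamental_group X x0\<^esub> path_class X (close_up \<alpha>)"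
    unfolding close_up_loop[OF loop, symmetric]
    using F.join[OF j pathin_reverse[OF \<alpha>(1)]] F.join[OF \<alpha>(1) \<gamma>'(1)] F.reverse[OF \<alpha>(1)] \<gamma>'
    by simp
qed

text \<open>The generating set is already invariant: conjugating the generator for
  \<open>\<alpha>\<close> and \<open>\<gamma>\<close> by the class of \<open>\<delta>\<close> gives
  the generator for \<open>path_join \<delta> \<alpha>\<close> and \<open>\<gamma>\<close>.\<close>

lemma normal_spanier_group_cover: "spanier_group_cover X x0 \<U> \<lhd> fundamental_group X x0"
  unfolding spanier_group_cover_def
proof (rule group.normal_generateI[OF group_fundamental_group[OF base(1)]])
  let ?G = "fundamental_group X x0"
  let ?S = "{path_class X (path_join (path_join \<alpha> \<gamma>) (path_reverse \<alpha>)) | \<alpha> \<gamma>.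
          pathin X \<alpha> \<and> \<alpha> 0 = x0 \<and> \<gamma> \<in> loops X (\<alpha> 1) \<and> (\<exists>U\<in>\<U>. \<gamma> ` {0..1} \<subseteq> U)}"
  interpret F: path_functor ?G X "\<lambda>p. path_class X (close_up p)"
    by (rule path_functor_close_up)
  show "?S \<subseteq> carrier ?G"
    using spanier_generator_eq(2) by (auto simp: fundamental_group_def)
  fix h g assume "h \<in> ?S" and g: "g \<in> carrier ?G"
  then obtain \<alpha> \<gamma> U where \<alpha>: "pathin X \<alpha>" "\<alpha> 0 = x0" and \<gamma>: "\<gamma> \<in> loops X (\<alpha> 1)" "U \<in> \<U>" "\<gamma> ` {0..1} \<subseteq> U"
    and h: "h = path_class X (path_join (path_join \<alpha> \<gamma>) (path_reverse \<alpha>))" by blast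
  obtain \<delta> where \<delta>: "\<delta> \<in> loops X x0" "g = path_class X \<delta>" using g by (auto simp: fundamental_group_def)
  have \<delta>': "pathin X \<delta>" "\<delta> 0 = x0" "\<delta> 1 = x0" using \<delta>(1) by (auto simp: loops_def)
  let ?\<beta> = "path_join \<delta> \<alpha>"
  have \<beta>: "pathin X ?\<beta>" using \<delta>' \<alpha> by (intro pathin_join) auto
  have car: "path_class X (close_up \<delta>) \<in> carrier ?G" "path_class X (close_up \<alpha>) \<in> carrier ?G"
    "path_class X (close_up \<gamma>) \<in> carrier ?G"
    using F.closed \<delta>' \<alpha> \<gamma>(1) by (auto simp: loops_def)
  let ?d = "path_class X (close_up \<delta>)" and ?a = "path_class X (close_up \<alpha>)"
    and ?c = "path_class X (close_up \<gamma>)"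
  have "path_class X (path_join (path_join ?\<beta> \<gamma>) (path_reverse ?\<beta>)) =
      path_class X (close_up ?\<beta>) \<otimes>\<^bsub>?G\<^esub> ?c \<otimes>\<^bsub>?G\<^esub> inv\<^bsub>?G\<^esub> path_class X (close_up ?\<beta>)"
    by (rule spanier_generator_eq(1)[OF \<beta>]) (use \<delta>'(2) \<gamma>(1) in simp_all)
  also have "path_class X (close_up ?\<beta>) = ?d \<otimes>\<^bsub>?G\<^esub> ?a"
    by (rule F.join[OF \<delta>'(1) \<alpha>(1)]) (use \<delta>'(3) \<alpha>(2) in simp)
  also have "(?d \<otimes>\<^bsub>?G\<^esub> ?a) \<otimes>\<^bsub>?G\<^esub> ?c \<otimes>\<^bsub>?G\<^esub> inv\<^bsub>?G\<^esub> (?d \<otimes>\<^bsub>?G\<^esub> ?a) =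
      ?d \<otimes>\<^bsub>?G\<^esub> (?a \<otimes>\<^bsub>?G\<^esub> ?c \<otimes>\<^bsub>?G\<^esub> inv\<^bsub>?G\<^esub> ?a) \<otimes>\<^bsub>?G\<^esub> inv\<^bsub>?G\<^esub> ?d"
    using car by (simp add: F.inv_mult_group F.m_assoc)
  also have "\<dots> = g \<otimes>\<^bsub>?G\<^esub> h \<otimes>\<^bsub>?G\<^esub> inv\<^bsub>?G\<^esub> g"
    unfolding h spanier_generator_eq(1)[OF \<alpha> \<gamma>(1)] \<delta>(2) close_up_loop[OF \<delta>(1)] ..
  finally have "path_class X (path_join (path_join ?\<beta> \<gamma>) (path_reverse ?\<beta>)) = g \<otimes>\<^bsub>?G\<^esub> h \<otimes>\<^bsub>?G\<^esub> inv\<^bsub>?G\<^esub> g" .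
  moreover have "path_class X (path_join (path_join ?\<beta> \<gamma>) (path_reverse ?\<beta>)) \<in> ?S"
  proof (rule CollectI, rule exI[of _ ?\<beta>], rule exI[of _ \<gamma>], intro conjI)
    show "\<exists>U\<in>\<U>. \<gamma> ` {0..1} \<subseteq> U" using \<gamma> by blast
  qed (use \<beta> \<delta>' \<gamma>(1) in simp_all)
  ultimately show "g \<otimes>\<^bsub>?G\<^esub> h \<otimes>\<^bsub>?G\<^esub> inv\<^bsub>?G\<^esub> g \<in> ?S" by simp
qed

lemma path_functor_quotient:
  "path_functor (fundamental_group X x0 Mod spanier_group_cover X x0 \<U>) X
    (\<lambda>p. spanier_group_cover X x0 \<U> #>\<^bsub>fundamental_group X x0\<^esub> path_class X (close_up p))"
proof -
  let ?G = "fundamental_group X x0" and ?H = "spanier_group_cover X x0 \<U>"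
  interpret F: path_functor ?G X "\<lambda>p. path_class X (close_up p)"
    by (rule path_functor_close_up)
  interpret N: normal ?H ?G by (rule normal_spanier_group_cover)
  note hom = N.r_coset_hom_Mod
  show ?thesis
  proof (intro path_functor.intro path_functor_axioms.intro)
    show "group (?G Mod ?H)" by (rule N.factorgroup_is_group)
    show "?H #>\<^bsub>?G\<^esub> path_class X (close_up p) \<in> carrier (?G Mod ?H)" if "pathin X p" for p
      using hom_in_carrier[OF hom] F.closed[OF that] .
    show "?H #>\<^bsub>?G\<^esub> path_class X (close_up (path_join p q)) =
        (?H #>\<^bsub>?G\<^esub> path_class X (close_up p)) \<otimes>\<^bsub>?G Mod ?H\<^esub> (?H #>\<^bsub>?G\<^esub> path_class X (close_up q))"
      if "pathin X p" "pathin X q" "p 1 = q 0" for p q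
      using hom_mult[OF hom] F.closed F.join that by metis
    show "?H #>\<^bsub>?G\<^esub> path_class X (close_up p) = ?H #>\<^bsub>?G\<^esub> path_class X (close_up q)"
      if "path_homotopic X p q" for p q
      using F.homotopic[OF that] by simp
  qed
qed

text \<open>The closed-up loop is itself one of the generators, with
  \<open>\<tau> (\<gamma> 1)\<close> as the connecting path.\<close>

lemma small_loop_in_spanier_group_cover:
  assumes \<gamma>: "pathin X \<gamma>" "\<gamma> 0 = \<gamma> 1" and U: "U \<in> \<U>" "\<gamma> ` {0..1} \<subseteq> U"
  shows "path_class X (close_up \<gamma>) \<in> spanier_group_cover X x0 \<U>"
  unfolding spanier_group_cover_def
proof (rule generate.incl, intro CollectI exI conjI)
  have x: "\<gamma> 1 \<in> topspace X" using pathin_in_topspace[OF \<gamma>(1)] by simp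
  show "path_class X (close_up \<gamma>) =
      path_class X (path_join (path_join (\<tau> (\<gamma> 1)) \<gamma>) (path_reverse (\<tau> (\<gamma> 1))))"
    by (simp add: close_up_def \<gamma>(2))
  show "pathin X (\<tau> (\<gamma> 1))" "\<tau> (\<gamma> 1) 0 = x0" using \<tau>[OF x] by auto
  show "\<gamma> \<in> loops X (\<tau> (\<gamma> 1) 1)" using \<tau>[OF x] \<gamma> by (simp add: loops_def)
qed (use U in blast)

end

lemma base_paths_exist:
  assumes conn: "path_connected_space X" and x0: "x0 \<in> topspace X"
  shows "\<exists>\<tau>. base_paths X x0 \<tau>"
proof -
  have "\<exists>q. pathin X q \<and> q 0 = x0 \<and> q 1 = x \<and> (x = x0 \<longrightarrow> q = (\<lambda>_. x0))" if x: "x \<in> topspace X" for x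
  proof (cases "x = x0")
    case True then show ?thesis using x0 by (intro exI[of _ "\<lambda>_. x0"]) (simp add: pathin_def)
  next
    case False then show ?thesis using conn x x0 unfolding path_connected_space_def by blast
  qed
  then obtain \<tau> where \<tau>: "\<And>x. x \<in> topspace X \<Longrightarrow> pathin X (\<tau> x) \<and> \<tau> x 0 = x0 \<and> \<tau> x 1 = x \<and> (x = x0 \<longrightarrow> \<tau> x = (\<lambda>_. x0))"
    using bchoice[of "topspace X" "\<lambda>x q. pathin X q \<and> q 0 = x0 \<and> q 1 = x \<and> (x = x0 \<longrightarrow> q = (\<lambda>_. x0))"] by blast
  then show ?thesis using x0 by (intro exI[of _ \<tau>]) (unfold_locales, auto)
qed

section \<open>The kernel of the shape map\<close>

lemma some_canonical_map:
  assumes "c \<in> normal_pointed_covers X x0" "x0 \<in> topspace X"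
  shows "canonical_map X x0 c (SOME p. canonical_map X x0 c p)"
  using canonical_map_exists[OF assms] by (rule someI_ex)

text \<open>The unit of the inverse limit is the family of trivial classes, so the kernel is the
  intersection of the kernels induced by the chosen canonical maps.\<close>

lemma shape_kernel_iff:
  "A \<in> kernel (fundamental_group X x0) (shape_group X x0) (shape_map X x0) \<longleftrightarrow>
    A \<in> carrier (fundamental_group X x0) \<and>
    (\<forall>c\<in>normal_pointed_covers X x0.
       induced_map (nerve_space c) (SOME p. canonical_map X x0 c p) A =
       path_class (nerve_space c) (\<lambda>_. vertex_point (snd c)))"
proof -
  have "\<one>\<^bsub>shape_group X x0\<^esub> =
      (\<lambda>c\<in>normal_pointed_covers X x0. path_class (nerve_space c) (\<lambda>_. vertex_point (snd c)))"
    by (simp add: shape_group_def nerve_pi1_def fundamental_group_def product_group_def)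
  then show ?thesis
    unfolding kernel_def shape_map_def by (auto simp: restrict_def fun_eq_iff)
qed

text \<open>The kernel of the induced homomorphism is a subgroup, so it is enough to treat
  generators of the Spanier group of the star cover. Their images are conjugates of loops lying in a
  single open star.\<close>

lemma spanier_group_subset_canonical_kernel:
  assumes p: "canonical_map X x0 c p" and x0: "x0 \<in> topspace X" and A: "A \<in> spanier_group X x0"
  shows "induced_map (nerve_space c) p A = path_class (nerve_space c) (\<lambda>_. vertex_point (snd c))"
proof -
  let ?R = "nerve_space c" and ?G = "fundamental_group X x0"
  have cont: "continuous_map X ?R p" and px0: "p x0 = vertex_point (snd c)"
    using p by (auto simp: canonical_map_def)
  let ?K = "fundamental_group ?R (p x0)"
  have pR: "p x \<in> topspace ?R" if "x \<in> topspace X" for x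
    using cont that by (auto simp: continuous_map_def)
  have "group_hom ?G ?K (induced_map ?R p)"
    unfolding group_hom_def group_hom_axioms_def
    using group_fundamental_group[OF x0] group_fundamental_group[OF pR[OF x0]] induced_map_hom[OF cont] by blast
  then interpret hom: group_hom ?G ?K "induced_map ?R p" .
  define St where "St U = {x \<in> topspace X. p x \<in> open_star (nerve (fst c)) U}" for U
  have "open_cover X (St ` fst c)"
    unfolding open_cover_def
  proof (intro conjI ballI)
    show "openin X V" if "V \<in> St ` fst c" for V
      using that openin_continuous_map_preimage[OF cont[unfolded nerve_space_def] openin_open_star]
      by (auto simp: St_def)
    have "\<exists>U\<in>fst c. x \<in> St U" if x: "x \<in> topspace X" for x
    proof -
      obtain \<sigma> U where "\<sigma> \<in> nerve (fst c)" "U \<in> \<sigma>" "p x \<in> open_star (nerve (fst c)) U"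
        using ex_open_star[OF pR[OF x, unfolded nerve_space_def] finite_nerve[where \<U> = "fst c"]] by blast
      then show ?thesis using x unfolding St_def nerve_def by blast
    qed
    then show "\<Union>(St ` fst c) = topspace X" by (auto simp: St_def)
  qed
  then have "A \<in> spanier_group_cover X x0 (St ` fst c)"
    using A by (auto simp: spanier_group_def)
  also have "\<dots> \<subseteq> kernel ?G ?K (induced_map ?R p)"
    unfolding spanier_group_cover_def
  proof (rule hom.G.generate_subgroup_incl[OF _ hom.subgroup_kernel], rule subsetI)
    fix B assume "B \<in> {path_class X (path_join (path_join \<alpha> \<gamma>) (path_reverse \<alpha>)) | \<alpha> \<gamma>.
       pathin X \<alpha> \<and> \<alpha> 0 = x0 \<and> \<gamma> \<in> loops X (\<alpha> 1) \<and> (\<exists>V\<in>St ` fst c. \<gamma> ` {0..1} \<subseteq> V)}"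
    then obtain \<alpha> \<gamma> U where \<alpha>: "pathin X \<alpha>" "\<alpha> 0 = x0" and \<gamma>: "\<gamma> \<in> loops X (\<alpha> 1)" "\<gamma> ` {0..1} \<subseteq> St U"
      and B: "B = path_class X (path_join (path_join \<alpha> \<gamma>) (path_reverse \<alpha>))" by blast
    have \<gamma>': "pathin X \<gamma>" "\<gamma> 0 = \<alpha> 1" "\<gamma> 1 = \<alpha> 1" using \<gamma>(1) by (auto simp: loops_def)
    have loop: "path_join (path_join \<alpha> \<gamma>) (path_reverse \<alpha>) \<in> loops X x0"
      using \<alpha> \<gamma>' by (auto simp: loops_def intro!: pathin_join pathin_reverse)
    have p\<alpha>: "pathin ?R (p \<circ> \<alpha>)" and p\<gamma>: "pathin ?R (p \<circ> \<gamma>)"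
      using cont \<alpha>(1) \<gamma>'(1) by (auto simp: pathin_def intro: continuous_map_compose)
    have "path_homotopic ?R (p \<circ> \<gamma>) (\<lambda>_. (p \<circ> \<gamma>) 0)"
      unfolding nerve_space_def
    proof (rule loop_in_open_star_null)
      show "pathin (geometric_realization (nerve (fst c))) (p \<circ> \<gamma>)" using p\<gamma> unfolding nerve_space_def .
      show "(p \<circ> \<gamma>) t \<in> open_star (nerve (fst c)) U" if "t \<in> {0..1}" for t
        using subsetD[OF \<gamma>(2) imageI[OF that]] by (simp add: St_def)
    qed (use \<gamma>' in \<open>auto simp: finite_nerve intro: nerve_mono\<close>)
    then have "path_homotopic ?R (p \<circ> \<gamma>) (\<lambda>_. (p \<circ> \<alpha>) 1)" using \<gamma>'(2) by simp
    from path_conjugate_null[OF p\<alpha> this]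
    have "path_homotopic ?R (p \<circ> path_join (path_join \<alpha> \<gamma>) (path_reverse \<alpha>)) (\<lambda>_. p x0)"
      unfolding comp_path_join comp_path_reverse using \<alpha>(2) by (simp add: o_def)
    then have "induced_map ?R p B = path_class ?R (\<lambda>_. p x0)"
      unfolding B using induced_map_path_class[OF _ cont] loop path_class_eqI by (metis (no_types, lifting) loops_def mem_Collect_eq)
    then show "B \<in> kernel ?G ?K (induced_map ?R p)"
      using loop unfolding kernel_def B by (simp add: fundamental_group_def)
  qed
  finally show ?thesis unfolding kernel_def px0 by (simp add: fundamental_group_def)
qed

lemma shape_kernel_subset_spanier_group_cover:
  assumes conn: "path_connected_space X" and lpc: "locally_path_connected_space X"
    and X: "paracompact_space X" "Hausdorff_space X" and x0: "x0 \<in> topspace X"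
    and A: "A \<in> kernel (fundamental_group X x0) (shape_group X x0) (shape_map X x0)"
    and \<U>: "open_cover X \<U>"
  shows "A \<in> spanier_group_cover X x0 \<U>"
proof -
  let ?G = "fundamental_group X x0" and ?H = "spanier_group_cover X x0 \<U>"
  obtain \<tau> where "base_paths X x0 \<tau>" using base_paths_exist[OF conn x0] by blast
  then interpret base_paths X x0 \<tau> .
  interpret N: normal ?H ?G by (rule normal_spanier_group_cover)
  interpret r: path_functor "?G Mod ?H" X "\<lambda>p. ?H #>\<^bsub>?G\<^esub> path_class X (close_up p)"
    by (rule path_functor_quotient)
  obtain \<B> where \<B>: "open_cover X \<B>" "\<And>x. x \<in> topspace X \<Longrightarrow> \<exists>U\<in>\<U>. \<Union>{V \<in> \<B>. x \<in> V} \<subseteq> U"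
    using barycentric_refinement[OF X \<U>] by metis
  \<comment> \<open>Local path connectedness makes these sets a cover. They provide the sets
    \<open>P V\<close>, inside which any two points can be joined.\<close>
  define \<W> where "\<W> = {W. openin X W \<and> path_connectedin X W \<and> (\<exists>B\<in>\<B>. W \<subseteq> B)}"
  have "\<exists>W\<in>\<W>. x \<in> W" if x: "x \<in> topspace X" for x
  proof -
    obtain B where B: "B \<in> \<B>" "x \<in> B" using open_coverD(3)[OF \<B>(1)] x by blast
    then obtain W where "openin X W" "path_connectedin X W" "x \<in> W" "W \<subseteq> B"
      using lpc open_coverD(1)[OF \<B>(1) B(1)] unfolding locally_path_connected_space by blast
    then show ?thesis using B(1) by (auto simp: \<W>_def)
  qed
  then have \<W>: "open_cover X \<W>"
    unfolding open_cover_def by (auto simp: \<W>_def dest: openin_subset)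
  obtain \<V> V0 where \<V>: "(\<V>, V0) \<in> normal_pointed_covers X x0" "cover_refines \<V> \<W>"
    using normal_pointed_cover_refining[OF X \<W> x0] by metis
  obtain P where P: "\<And>V. V \<in> \<V> \<Longrightarrow> P V \<in> \<W>" "\<And>V. V \<in> \<V> \<Longrightarrow> V \<subseteq> P V"
    using \<V>(2) unfolding cover_refines_def by metis
  define p where "p = (SOME p. canonical_map X x0 (\<V>, V0) p)"
  have p: "canonical_map X x0 (\<V>, V0) p" unfolding p_def by (rule some_canonical_map[OF \<V>(1) x0])
  let ?R = "geometric_realization (nerve \<V>)"
  have cont: "continuous_map X ?R p" using p by (simp add: canonical_map_def nerve_space_def)
  obtain \<alpha> where \<alpha>: "\<alpha> \<in> loops X x0" "A = path_class X \<alpha>"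
    using A unfolding shape_kernel_iff by (auto simp: fundamental_group_def)
  have \<alpha>': "pathin X \<alpha>" "\<alpha> 0 = x0" "\<alpha> 1 = x0" using \<alpha>(1) by (auto simp: loops_def)
  have "path_class ?R (p \<circ> \<alpha>) = path_class ?R (\<lambda>_. vertex_point V0)"
    using A \<V>(1) unfolding shape_kernel_iff \<alpha>(2)
    by (metis \<alpha>'(1) cont fst_conv induced_map_path_class nerve_space_def p_def snd_conv)
  moreover have "pathin ?R (p \<circ> \<alpha>)"
    using cont \<alpha>'(1) by (auto simp: pathin_def intro: continuous_map_compose)
  ultimately have null: "path_homotopic ?R (p \<circ> \<alpha>) (\<lambda>_. vertex_point V0)"
    using path_class_eq_iff by blast
  have "?H #>\<^bsub>?G\<^esub> path_class X (close_up \<alpha>) = \<one>\<^bsub>?G Mod ?H\<^esub>"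
  proof (rule r.trivial_if_null_in_nerve[OF \<alpha>' _ null])
    show "x \<in> V" if "V \<in> \<V>" "x \<in> topspace X" "p x \<in> open_star (nerve \<V>) V" for V x
      using p that unfolding canonical_map_def by auto
    show "V \<subseteq> P V" "path_connectedin X (P V)" if "V \<in> \<V>" for V
      using P that by (auto simp: \<W>_def)
    fix u v \<gamma>
    assume uv: "u \<in> \<V>" "v \<in> \<V>" "P u \<inter> P v \<noteq> {}" and \<gamma>: "pathin X \<gamma>" "\<gamma> 0 = \<gamma> 1" "\<gamma> ` {0..1} \<subseteq> P u \<union> P v"
    obtain Bu Bv where B: "Bu \<in> \<B>" "P u \<subseteq> Bu" "Bv \<in> \<B>" "P v \<subseteq> Bv"
      using P(1) uv(1,2) unfolding \<W>_def by blast
    \<comment> \<open>Both \<open>Bu\<close> and \<open>Bv\<close> contain the common point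
      \<open>x\<close>, so the barycentric property at \<open>x\<close> places them in one
      \<open>U\<close>.\<close>
    obtain x where x: "x \<in> P u" "x \<in> P v" using uv(3) by blast
    have "x \<in> topspace X" using x(1) B open_coverD(2)[OF \<B>(1)] by blast
    then obtain U where U: "U \<in> \<U>" "\<Union>{V \<in> \<B>. x \<in> V} \<subseteq> U" using \<B>(2) by blast
    have "\<gamma> ` {0..1} \<subseteq> U" using \<gamma>(3) B x U(2) by blast
    then have "path_class X (close_up \<gamma>) \<in> ?H"
      using small_loop_in_spanier_group_cover[OF \<gamma>(1,2) U(1)] by blast
    then show "?H #>\<^bsub>?G\<^esub> path_class X (close_up \<gamma>) = \<one>\<^bsub>?G Mod ?H\<^esub>"
      using N.coset_join2[OF _ N.subgroup_axioms] N.subset by auto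
  qed
  \<comment> \<open>The coset of \<open>A\<close> is the unit of the quotient, that is,
    \<open>A\<close> lies in \<open>?H\<close>.\<close>
  then have "?H #>\<^bsub>?G\<^esub> A = ?H" by (simp add: \<alpha>(2) close_up_loop[OF \<alpha>(1)])
  then show ?thesis
    using N.coset_join1[OF _ _ N.subgroup_axioms] A unfolding shape_kernel_iff by blast
qed

theorem shape_kernel_eq_spanier_group:
  assumes "path_connected_space X" "locally_path_connected_space X"
    "paracompact_space X" "Hausdorff_space X" "x0 \<in> topspace X"
  shows "kernel (fundamental_group X x0) (shape_group X x0) (shape_map X x0) = spanier_group X x0"
proof
  show "kernel (fundamental_group X x0) (shape_group X x0) (shape_map X x0) \<subseteq> spanier_group X x0"
    using shape_kernel_subset_spanier_group_cover[OF assms] by (auto simp: spanier_group_def)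
  show "spanier_group X x0 \<subseteq> kernel (fundamental_group X x0) (shape_group X x0) (shape_map X x0)"
  proof
    fix A assume A: "A \<in> spanier_group X x0"
    obtain \<tau> where "base_paths X x0 \<tau>" using base_paths_exist[OF assms(1,5)] by blast
    then interpret base_paths X x0 \<tau> .
    \<comment> \<open>One cover is enough to see that the intersection defining the Spanier group
      lies in the carrier.\<close>
    have "open_cover X {topspace X}" by (simp add: open_cover_def)
    then have "A \<in> spanier_group_cover X x0 {topspace X}" using A by (auto simp: spanier_group_def)
    then have "A \<in> carrier (fundamental_group X x0)"
      using normal_imp_subgroup[OF normal_spanier_group_cover] subgroup.subset by blast
    then show "A \<in> kernel (fundamental_group X x0) (shape_group X x0) (shape_map X x0)"
      unfolding shape_kernel_iff
      using spanier_group_subset_canonical_kernel[OF some_canonical_map _ A] assms(5) by blast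
  qed
qed

theorem corollary36:
  fixes X :: "'a topology" and x0 :: 'a
  assumes "path_connected_space X"
    and "locally_path_connected_space X"
    and "paracompact_space X"
    and "Hausdorff_space X"
    and "x0 \<in> topspace X"
  shows "pi1_shape_injective X x0 \<longleftrightarrow> spanier_group X x0 = {\<one>\<^bsub>fundamental_group X x0\<^esub>}"
  unfolding pi1_shape_injective_def shape_kernel_eq_spanier_group[OF assms] ..

end
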